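(* There does not exist a formula for the roots of a degree five polynomial equation built out of a finite combination of analytic functions, field operations, and any level of nested radicals.
   Context: The polynomial is the general monic polynomial $p(z)=z^5+a_4z^4+a_3z^3+a_2z^2+a_1z+a_0$ of degree five with complex coefficients $a_0,\dots,a_4$ and complex roots $z_1,\dots,z_5$. A formula for the roots means an expression in the coefficients $a_0,\dots,a_4$ that expresses (reconstructs) the roots $z_1,\dots,z_5$ of the general polynomial $p$ in terms of its coefficients. The expression is built from $a_0,\dots,a_4$ by finitely many uses of: (single-valued) analytic functions $\mathbb{C}^m\to\mathbb{C}$, for any $m$; the field operations (addition, subtraction, multiplication, division); and radicals $\sqrt[n]{\cdot}$ with $n$ a positive integer. A radical is multi-valued: for nonzero $z=re^{i\theta}\in\mathbb{C}$, the values of $\sqrt[n]{z}$ are the $n$ complex numbers $w=\sqrt[n]{r}\,e^{\frac{i}{n}(\theta+2k\pi)}$, $k=0,1,\dots,n-1$, satisfying $w^n=z$. Radicals may be nested, that is, applied to expressions that themselves contain radicals, to any finite number of levels. *)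

theory Defs
  imports "HOL-Analysis.Analysis"
begin

text \<open>Analyticity on all of \<open>\<complex>\<^sup>m\<close>: near every point \<open>c\<close> the function is the sum of an
  (unconditionally convergent) power series in \<open>m\<close> variables. Points of \<open>\<complex>\<^sup>m\<close> and multi-indices
  are lists of length \<open>m\<close>; values of \<open>f\<close> on lists of any other length are irrelevant.
  For \<open>m = 0\<close> these are the constants.\<close>

definition analytic_Cm :: "nat \<Rightarrow> (complex list \<Rightarrow> complex) \<Rightarrow> bool" where
  "analytic_Cm m f \<longleftrightarrow>
     (\<forall>c. length c = m \<longrightarrow>
        (\<exists>r>0. \<exists>\<alpha> :: nat list \<Rightarrow> complex.
           \<forall>z. length z = m \<longrightarrow> (\<forall>i<m. cmod (z ! i - c ! i) < r) \<longrightarrow>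
             ((\<lambda>k. \<alpha> k * (\<Prod>i<m. (z ! i - c ! i) ^ (k ! i))) has_sum f z) {k. length k = m}))"

text \<open>The index type \<open>5\<close> has the elements \<open>0, 1, 2, 3, 4\<close>.\<close>

datatype expr =
    Coeff 5
  | Analytic "complex list \<Rightarrow> complex" "expr list"
  | Add expr expr
  | Sub expr expr
  | Mul expr expr
  | Div expr expr
  | Radical nat expr

fun well_formed :: "expr \<Rightarrow> bool" where
  "well_formed (Coeff i) \<longleftrightarrow> True"
| "well_formed (Analytic f es) \<longleftrightarrow> analytic_Cm (length es) f \<and> (\<forall>e\<in>set es. well_formed e)"
| "well_formed (Add e1 e2) \<longleftrightarrow> well_formed e1 \<and> well_formed e2"
| "well_formed (Sub e1 e2) \<longleftrightarrow> well_formed e1 \<and> well_formed e2"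
| "well_formed (Mul e1 e2) \<longleftrightarrow> well_formed e1 \<and> well_formed e2"
| "well_formed (Div e1 e2) \<longleftrightarrow> well_formed e1 \<and> well_formed e2"
| "well_formed (Radical n e) \<longleftrightarrow> n > 0 \<and> well_formed e"

text \<open>Radicals are multi-valued, so evaluation is a relation: \<open>has_value a e v\<close> says that \<open>v\<close> is one
  of the values of \<open>e\<close> at the coefficients \<open>a\<close>, for some choice of a value of each radical.
  A choice that makes a denominator vanish contributes no value.\<close>

inductive has_value :: "complex ^ 5 \<Rightarrow> expr \<Rightarrow> complex \<Rightarrow> bool" for a where
  "has_value a (Coeff i) (a $ i)"
| "list_all2 (has_value a) es vs \<Longrightarrow> has_value a (Analytic f es) (f vs)"
| "has_value a e1 u \<Longrightarrow> has_value a e2 v \<Longrightarrow> has_value a (Add e1 e2) (u + v)"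
| "has_value a e1 u \<Longrightarrow> has_value a e2 v \<Longrightarrow> has_value a (Sub e1 e2) (u - v)"
| "has_value a e1 u \<Longrightarrow> has_value a e2 v \<Longrightarrow> has_value a (Mul e1 e2) (u * v)"
| "has_value a e1 u \<Longrightarrow> has_value a e2 v \<Longrightarrow> v \<noteq> 0 \<Longrightarrow> has_value a (Div e1 e2) (u / v)"
| "has_value a e z \<Longrightarrow> w ^ n = z \<Longrightarrow> has_value a (Radical n e) w"

text \<open>The condition \<open>w ^ n = z\<close> describes the \<open>n\<close> classical values of the radical
  (and just \<open>0\<close> if \<open>z = 0\<close>).\<close>

lemma radical_values:
  assumes "n > 0"
  shows "{w. w ^ n = z} =
           {complex_of_real (root n (cmod z)) * cis ((Arg z + 2 * real k * pi) / real n) | k. k < n}"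
proof (cases "z = 0")
  case True
  have "{w::complex. w ^ n = 0} = {0}" using assms by auto
  moreover have "{complex_of_real (root n (cmod 0)) * cis ((Arg 0 + 2 * real k * pi) / real n) | k. k < n} = {0}"
    using assms by auto
  ultimately show ?thesis using True by simp
next
  case False
  define c' where "c' = complex_of_real (root n (cmod z)) * cis (Arg z / real n)"
  have "{w. w ^ n = z} = (\<lambda>x. c' * x) ` {x. x ^ n = 1}"
    using bij_betw_imp_surj_on[OF bij_betw_nth_root_unity[OF False assms]] by (simp add: c'_def)
  also have "{x::complex. x ^ n = 1} = (\<lambda>k. cis (2 * pi * real k / real n)) ` {..<n}"
    using bij_betw_imp_surj_on[OF Complex.bij_betw_roots_unity[OF assms]] by simp
  also have "(\<lambda>x. c' * x) ` (\<lambda>k. cis (2 * pi * real k / real n)) ` {..<n} =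
      (\<lambda>k. complex_of_real (root n (cmod z)) * cis ((Arg z + 2 * real k * pi) / real n)) ` {..<n}"
    unfolding image_image
    by (intro image_cong refl) (simp add: c'_def mult.assoc cis_mult add_divide_distrib mult.commute mult.left_commute)
  finally show ?thesis by (auto simp: image_def)
qed

definition quintic :: "complex ^ 5 \<Rightarrow> complex poly" where
  "quintic a = [:a $ 0, a $ 1, a $ 2, a $ 3, a $ 4, 1:]"

text \<open>A formula for the roots of the general quintic: every root is among the values of the
  expression. As usual for the general polynomial, this is required only for generic coefficients,
  i.e. off a closed nowhere dense set of exceptional coefficients (such as those at which
  denominators vanish).\<close>

definition root_formula :: "expr \<Rightarrow> bool" where
  "root_formula e \<longleftrightarrow> well_formed e \<and>
     (\<exists>U. open U \<and> closure U = UNIV \<and>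
        (\<forall>a\<in>U. \<forall>z. poly (quintic a) z = 0 \<longrightarrow> has_value a e z))"

end

theory Submission
  imports Defs "HOL-Complex_Analysis.Conformal_Mappings"
    "HOL-Computational_Algebra.Fundamental_Theorem_Algebra"
begin

text \<open>The proof is Arnold's topological one. Parametrise the coefficients by the roots
  \<open>y \<in> \<complex>\<^sup>5\<close> and replace the formula by a tower of steps \<open>x\<^sub>j ^ n = F / G\<close>, where \<open>F\<close> and \<open>G\<close> are
  analytic in \<open>y\<close> and the earlier \<open>x\<^sub>i\<close> and symmetric in \<open>y\<close>. For a permutation \<open>\<sigma>\<close>, the complex
  line through a generic \<open>y\<close> and its permutation \<open>\<sigma> y\<close> meets the branch points of the tower in a
  countable set only, so a path in this line from \<open>y\<close> to \<open>\<sigma> y\<close> avoids them. Since \<open>y\<close> and \<open>\<sigma> y\<close> have the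
  same coefficients, continuation along the path permutes the finitely many solutions of the
  tower over \<open>y\<close>, while it permutes the roots by \<open>\<sigma>\<close>. Going around multiplies a radical by a root of
  unity once the earlier radicals return to themselves, so commutators fix one more level
  of radicals. Every 3-cycle of the five roots is a commutator of 3-cycles; hence some
  monodromy map fixes the whole tower and yet moves a root.\<close>

section \<open>Zeros and roots of continuous functions\<close>

text \<open>The obstacle is degeneracy. A radicand or a denominator may vanish identically for one
  choice of the earlier radicals and not for another, so the branch points are not the zeros of one
  function of the coefficients. Regularity is therefore judged section by section: near a regular
  point each radicand is nowhere zero or identically zero along each local section
  (\<open>zero_const\<close>), and a section along which a denominator vanishes identically has no
  extension. Restriction to a complex line turns these conditions into one-variable statements about
  isolated zeros. Values of the formula that are not roots must be tolerated as well. Hence the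
  differences \<open>H y x - y $ i\<close> are carried along as extra test functions; that their
  vanishing is constant along a lift tells which solutions represent which root. Loops in
  coefficient space are never concatenated: all monodromy maps act on the one finite set
  \<open>Sol T y\<close> and are composed there as permutations.\<close>

definition zero_const :: "('a \<Rightarrow> complex) \<Rightarrow> 'a set \<Rightarrow> bool" where
  "zero_const f W \<longleftrightarrow> (\<forall>p\<in>W. \<forall>q\<in>W. f p = 0 \<longleftrightarrow> f q = 0)"

lemma zero_const_subset: "zero_const f W \<Longrightarrow> V \<subseteq> W \<Longrightarrow> zero_const f V"
  unfolding zero_const_def by blast

lemma zero_const_Un:
  "zero_const f V \<Longrightarrow> zero_const f W \<Longrightarrow> V \<inter> W \<noteq> {} \<Longrightarrow> zero_const f (V \<union> W)"
  unfolding zero_const_def by blast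

text \<open>An accumulation point of such zeros would, by the identity theorem, force
  \<open>f\<close> to vanish on a ball around it, and inside that ball no zero is irregular.
  Components of \<open>W\<close> on which \<open>f\<close> is identically zero contribute
  nothing.\<close>

lemma countable_irregular_zeros:
  assumes "f holomorphic_on W" "open W"
  shows "countable {z \<in> W. \<not> (\<forall>\<^sub>F w in nhds z. f w = 0 \<longleftrightarrow> f z = 0)}" (is "countable ?B")
proof -
  have zero: "f w = 0" if "w \<in> ?B" for w
  proof (rule ccontr)
    assume "f w \<noteq> 0"
    have "continuous_on W f"
      by (rule holomorphic_on_imp_continuous_on[OF assms(1)])
    then have "isCont f w"
      using that assms(2) by (simp add: continuous_on_eq_continuous_at)
    then have "(f \<longlongrightarrow> f w) (nhds w)"
      by (simp add: continuous_at isCont_def flip: tendsto_at_iff_tendsto_nhds)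
    from tendsto_imp_eventually_ne[OF this \<open>f w \<noteq> 0\<close>] have "\<forall>\<^sub>F x in nhds w. f x \<noteq> 0" .
    with that \<open>f w \<noteq> 0\<close> show False by simp
  qed
  have "\<not> z islimpt ?B" if zW: "z \<in> W" for z
  proof
    assume lim: "z islimpt ?B"
    obtain r where r: "r > 0" "ball z r \<subseteq> W"
      using openE[OF assms(2) zW] by blast
    have lim': "z islimpt (?B \<inter> ball z r)"
      using r(1) by (intro islimpt_Int_eventually[OF lim] eventually_at_in_open') auto
    have hol: "f holomorphic_on ball z r"
      using assms(1) r(2) by (rule holomorphic_on_subset)
    have "f w = 0" if "w \<in> ball z r" for w
    proof (rule analytic_continuation[OF hol _ _ _ _ lim' _ that])
      show "f u = 0" if "u \<in> ?B \<inter> ball z r" for u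
        using zero that by blast
    qed (use r(1) in auto)
    moreover have "?B \<inter> ball z r \<noteq> {}"
      using lim' islimpt_EMPTY by metis
    then obtain w where w: "w \<in> ?B" "w \<in> ball z r"
      by blast
    ultimately have "\<forall>\<^sub>F x in nhds w. f x = 0 \<longleftrightarrow> f w = 0"
      unfolding eventually_nhds by (intro exI[of _ "ball z r"]) auto
    with w show False by simp
  qed
  then have "?B sparse_in W"
    by (simp add: sparse_in_open assms)
  then have "countable (W \<inter> ?B)"
    by (rule sparse_imp_countable[OF assms(2)])
  then show ?thesis
    by (rule countable_subset[rotated]) auto
qed

text \<open>The difference quotient of \<open>f\<close> is that of \<open>g\<close> divided by the
  cofactor \<open>S\<close> of \<open>f z - f p\<close> in \<open>f z ^ n - f p ^ n\<close>. By
  continuity \<open>S\<close> tends to \<open>n * f p ^ (n - 1)\<close>, which is nonzero unless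
  \<open>g\<close> vanishes identically.\<close>

lemma holomorphic_on_continuous_nth_root:
  assumes "open W" "continuous_on W f" "g holomorphic_on W" "n > 0"
    and pow: "\<And>z. z \<in> W \<Longrightarrow> f z ^ n = g z" and "zero_const g W"
  shows "f holomorphic_on W"
proof (cases "\<exists>z\<in>W. g z = 0")
  case True
  then have "g z = 0" if "z \<in> W" for z
    using assms(6) that unfolding zero_const_def by blast
  then have "f z = 0" if "z \<in> W" for z
    using pow[OF that] that by simp
  then show ?thesis
    by (metis holomorphic_on_const holomorphic_transform)
next
  case False
  have "f field_differentiable (at p)" if p: "p \<in> W" for p
  proof -
    define S where "S z = (\<Sum>i<n. f p ^ (n - Suc i) * f z ^ i)" for z
    have fac: "g z - g p = (f z - f p) * S z" if "z \<in> W" for z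
      using pow[OF that] pow[OF p] power_diff_sumr2[of "f z" n "f p"] by (simp add: S_def)
    have fp: "f p \<noteq> 0"
      using False p pow[OF p] \<open>n > 0\<close> by (metis power_0_left not_gr_zero)
    have "S p = of_nat n * f p ^ (n - 1)"
    proof -
      have "S p = (\<Sum>i<n. f p ^ (n - 1))"
        unfolding S_def by (rule sum.cong) (simp_all flip: power_add)
      then show ?thesis by simp
    qed
    then have Sp: "S p \<noteq> 0" using fp \<open>n > 0\<close> by simp
    have contf: "isCont f p"
      using assms(1,2) p continuous_on_eq_continuous_at by blast
    then have contS: "isCont S p"
      unfolding S_def by (intro continuous_intros)
    obtain D where D: "(g has_field_derivative D) (at p)"
      using assms(1,3) p holomorphic_on_open by blast
    then have "((\<lambda>z. (g z - g p) / (z - p)) \<longlongrightarrow> D) (at p)"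
      by (simp add: has_field_derivative_iff)
    moreover have "(S \<longlongrightarrow> S p) (at p)"
      using contS by (simp add: isCont_def)
    ultimately have lim: "((\<lambda>z. (g z - g p) / (z - p) / S z) \<longlongrightarrow> D / S p) (at p)"
      using Sp by (intro tendsto_intros)
    have "\<forall>\<^sub>F z in at p. S z \<noteq> 0"
      using \<open>(S \<longlongrightarrow> S p) (at p)\<close> Sp by (rule tendsto_imp_eventually_ne)
    moreover have "\<forall>\<^sub>F z in at p. z \<in> W"
      using assms(1) p by (simp add: eventually_at_in_open')
    ultimately have "\<forall>\<^sub>F z in at p. (g z - g p) / (z - p) / S z = (f z - f p) / (z - p)"
      by eventually_elim (simp add: fac)
    then have "((\<lambda>z. (f z - f p) / (z - p)) \<longlongrightarrow> D / S p) (at p)"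
      using lim tendsto_cong by fast
    then show ?thesis
      by (auto simp: field_differentiable_def has_field_derivative_iff)
  qed
  then show ?thesis
    using assms(1) by (simp add: holomorphic_on_def field_differentiable_at_within)
qed

text \<open>\<open>zero_const\<close> prevents branches from merging: either 0 is the only root
  everywhere, or the roots are one continuous branch times the roots of unity.\<close>

lemma local_nth_roots:
  fixes h :: "'a::topological_space \<Rightarrow> complex"
  assumes "open W" "q \<in> W" "continuous_on W h" "n > 0" "zero_const h W"
  shows "\<exists>V R. open V \<and> q \<in> V \<and> V \<subseteq> W \<and> finite R \<and> (\<forall>r\<in>R. continuous_on V r) \<and>
           (\<forall>p\<in>V. {w. w ^ n = h p} = (\<lambda>r. r p) ` R)"
proof (cases "h q = 0")
  case True
  then have "h p = 0" if "p \<in> W" for p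
    using assms that unfolding zero_const_def by blast
  then have "\<forall>p\<in>W. {w. w ^ n = h p} = (\<lambda>r. r p) ` {\<lambda>p. 0}"
    using assms(4) by auto
  then show ?thesis
    using assms by (intro exI[of _ W] exI[of _ "{\<lambda>p. 0}"]) auto
next
  case False
  \<comment> \<open>The open unit disc about 1 misses the slit of \<open>Ln\<close>, so the
    logarithm of the normalised value \<open>h p / h q\<close> is continuous on
    \<open>V\<close>.\<close>
  define V where "V = {p \<in> W. h p / h q \<in> ball 1 1}"
  have cont: "continuous_on W (\<lambda>p. h p / h q)"
    using assms(3) False by (intro continuous_intros) auto
  have V: "open V" "q \<in> V" "V \<subseteq> W"
    using continuous_on_open_vimage[OF assms(1), of "\<lambda>p. h p / h q"] cont assms(2) False
    by (auto simp: V_def vimage_def Collect_conj_eq Int_commute)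
  have nonpos: "h p / h q \<notin> \<real>\<^sub>\<le>\<^sub>0" if "p \<in> V" for p
  proof
    assume *: "h p / h q \<in> \<real>\<^sub>\<le>\<^sub>0"
    then have "Re (h p / h q) \<le> 0" "norm (1 - h p / h q) < 1"
      using that by (auto simp: complex_nonpos_Reals_iff V_def dist_norm)
    then show False using complex_Re_le_cmod[of "1 - h p / h q"] by simp
  qed
  define c where "c = exp (Ln (h q) / n)"
  define s where "s p = c * exp (Ln (h p / h q) / n)" for p
  have s: "s p ^ n = h p" "s p \<noteq> 0" if "p \<in> V" for p
  proof -
    have "h p / h q \<noteq> 0" using nonpos[OF that] by auto
    then have "s p ^ n = h q * (h p / h q)"
      using False \<open>n > 0\<close> by (simp add: s_def c_def power_mult_distrib flip: exp_of_nat_mult)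
    then show "s p ^ n = h p" using False by simp
  qed (simp add: s_def c_def)
  define R where "R = (\<lambda>z p. z * s p) ` {z. z ^ n = 1}"
  have "continuous_on V s"
    unfolding s_def using nonpos \<open>n > 0\<close>
    by (intro continuous_on_mult continuous_on_const continuous_on_exp continuous_on_divide
          continuous_on_Ln' continuous_on_subset[OF assms(3) V(3)]) (use False in auto)
  then have "\<forall>r\<in>R. continuous_on V r"
    by (auto simp: R_def intro!: continuous_intros)
  moreover have "finite R"
    unfolding R_def using finite_roots_unity[of n] \<open>n > 0\<close> by (intro finite_imageI) simp
  moreover have "{w. w ^ n = h p} = (\<lambda>r. r p) ` R" if "p \<in> V" for p
  proof -
    have "w \<in> (\<lambda>r. r p) ` R" if "w ^ n = h p" for w
    proof -
      have "(w / s p) ^ n = 1"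
        using that s[OF \<open>p \<in> V\<close>] by (metis power_divide divide_self power_not_zero)
      then show ?thesis
        unfolding R_def using s(2)[OF \<open>p \<in> V\<close>]
        by (auto simp: image_image intro!: image_eqI[of _ _ "w / s p"])
    qed
    then show ?thesis
      using s[OF that] by (auto simp: R_def power_mult_distrib)
  qed
  ultimately show ?thesis
    using V by blast
qed

text \<open>Where the radicand is nonzero, \<open>g / f\<close> is continuous with values among the
  \<open>n\<close>-th roots of unity, hence constant on a connected set; otherwise both functions
  vanish throughout.\<close>

lemma continuous_same_nth_power:
  fixes f g :: "'a::topological_space \<Rightarrow> complex"
  assumes "connected S" "continuous_on S f" "continuous_on S g" "n > 0"
    and pow: "\<And>s. s \<in> S \<Longrightarrow> f s ^ n = h s" "\<And>s. s \<in> S \<Longrightarrow> g s ^ n = h s"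
    and "zero_const h S" "a \<in> S" "s \<in> S" "g a = c * f a"
  shows "g s = c * f s"
proof (cases "h a = 0")
  case True
  then have "h s = 0" using assms(7-9) unfolding zero_const_def by blast
  then show ?thesis using pow[OF \<open>s \<in> S\<close>] \<open>n > 0\<close> by simp
next
  case False
  then have nz: "f t \<noteq> 0" if "t \<in> S" for t
    using assms(7,8) pow(1)[OF that] that \<open>n > 0\<close>
    unfolding zero_const_def by (metis power_0_left not_gr_zero)
  have "(\<lambda>t. g t / f t) constant_on S"
  proof (rule continuous_finite_range_constant[OF assms(1)])
    show "continuous_on S (\<lambda>t. g t / f t)"
      using assms nz by (intro continuous_intros) auto
    have "(\<lambda>t. g t / f t) ` S \<subseteq> {z. z ^ n = 1}"
      using nz pow by (auto simp: power_divide) (metis power_not_zero)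
    then show "finite ((\<lambda>t. g t / f t) ` S)"
      by (rule finite_subset) (use finite_roots_unity[of n] \<open>n > 0\<close> in simp)
  qed
  then have "g s / f s = g a / f a"
    using assms(8,9) unfolding constant_on_def by metis
  then show ?thesis
    using nz assms(8-10) by (simp add: field_simps)
qed

section \<open>Towers of radicals\<close>

type_synonym fn = "complex ^ 5 \<Rightarrow> (nat \<Rightarrow> complex) \<Rightarrow> complex"
type_synonym step = "nat \<times> fn \<times> fn"

text \<open>Only the two consequences of analyticity that the proof needs are recorded: continuity, and
  holomorphy along holomorphic curves. \<open>L\<close> bounds the entries of the state \<open>x\<close> on which the
  function depends.\<close>

definition admissible :: "nat \<Rightarrow> fn \<Rightarrow> bool" where
  "admissible L F \<longleftrightarrow>
     (\<forall>y x x'. (\<forall>i<L. x i = x' i) \<longrightarrow> F y x = F y x') \<and>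
     continuous_on UNIV (\<lambda>(y, x). F y x) \<and>
     (\<forall>W u x. open W \<longrightarrow> (\<forall>i. (\<lambda>t. u t $ i) holomorphic_on W) \<longrightarrow>
        (\<forall>i. (\<lambda>t. x t i) holomorphic_on W) \<longrightarrow> (\<lambda>t. F (u t) (x t)) holomorphic_on W)"

lemma admissible_cong: "admissible L F \<Longrightarrow> (\<And>i. i < L \<Longrightarrow> x i = x' i) \<Longrightarrow> F y x = F y x'"
  unfolding admissible_def by blast

lemma admissible_mono: "admissible L F \<Longrightarrow> L \<le> M \<Longrightarrow> admissible M F"
  unfolding admissible_def by (meson order_less_le_trans)

lemma admissible_continuous:
  assumes "admissible L F" "continuous_on W l" "\<And>i. continuous_on W (\<lambda>p. X p i)"
  shows "continuous_on W (\<lambda>p. F (l p) (X p))"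
proof -
  have "continuous_on W (\<lambda>p. (l p, X p))"
    using assms by (intro continuous_on_Pair continuous_on_coordinatewise_then_product)
  from continuous_on_compose2[OF _ this, of UNIV "\<lambda>(y, x). F y x"] show ?thesis
    using assms(1) by (simp add: admissible_def)
qed

lemma admissible_holomorphic:
  assumes "admissible L F" "open W" "\<And>i. (\<lambda>t. u t $ i) holomorphic_on W"
    "\<And>i. i < L \<Longrightarrow> (\<lambda>t. x t i) holomorphic_on W"
  shows "(\<lambda>t. F (u t) (x t)) holomorphic_on W"
proof -
  \<comment> \<open>The definition of \<open>admissible\<close> wants every entry of the state
    holomorphic; padding with 0 from \<open>L\<close> on achieves this without changing the value of
    \<open>F\<close>.\<close>
  define x' where "x' t i = (if i < L then x t i else 0)" for t i
  have "(\<lambda>t. x' t i) holomorphic_on W" for i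
    using assms(4)[of i] by (cases "i < L") (simp_all add: x'_def)
  then have "(\<lambda>t. F (u t) (x' t)) holomorphic_on W"
    using assms(1-3) unfolding admissible_def by blast
  moreover have "F (u t) (x' t) = F (u t) (x t)" for t
    by (rule admissible_cong[OF assms(1)]) (simp add: x'_def)
  ultimately show ?thesis by simp
qed

abbreviation deg :: "step list \<Rightarrow> nat \<Rightarrow> nat" where "deg T j \<equiv> fst (T ! j)"
abbreviation num :: "step list \<Rightarrow> nat \<Rightarrow> fn" where "num T j \<equiv> fst (snd (T ! j))"
abbreviation den :: "step list \<Rightarrow> nat \<Rightarrow> fn" where "den T j \<equiv> snd (snd (T ! j))"

text \<open>A step \<open>(n, F, G)\<close> adjoins a value of the \<open>n\<close>-th radical of \<open>F / G\<close>; the case \<open>n = 1\<close> is a division.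
  States vanish beyond the length of the tower, which makes the solution set finite.\<close>

definition tower :: "step list \<Rightarrow> bool" where
  "tower T \<longleftrightarrow> (\<forall>j<length T. deg T j > 0 \<and> admissible j (num T j) \<and> admissible j (den T j))"

definition Sol :: "step list \<Rightarrow> complex ^ 5 \<Rightarrow> (nat \<Rightarrow> complex) set" where
  "Sol T y = {x. (\<forall>j<length T. den T j y x \<noteq> 0 \<and> x j ^ deg T j = num T j y x / den T j y x) \<and>
                 (\<forall>j\<ge>length T. x j = 0)}"

lemma tower_Nil: "tower []"
  by (simp add: tower_def)

lemma tower_snoc:
  "tower (T @ [(n, F, G)]) \<longleftrightarrow>
     tower T \<and> n > 0 \<and> admissible (length T) F \<and> admissible (length T) G"
  unfolding tower_def by (auto simp: nth_append less_Suc_eq)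

lemma Sol_Nil: "Sol [] y = {\<lambda>_. 0}"
  by (auto simp: Sol_def)

lemma Sol_snoc:
  assumes "tower T" "admissible (length T) F" "admissible (length T) G"
  shows "Sol (T @ [(n, F, G)]) y =
    {x(length T := w) | x w. x \<in> Sol T y \<and> G y x \<noteq> 0 \<and> w ^ n = F y x / G y x}"
proof -
  let ?N = "length T"
  have eq: "H y (x(?N := w)) = H y x" if "admissible j H" "j \<le> ?N" for H j x w
    by (rule admissible_cong[OF that(1)]) (use that(2) in auto)
  have eqs: "F y (x(?N := w)) = F y x" "G y (x(?N := w)) = G y x"
    "\<And>j. j < ?N \<Longrightarrow> num T j y (x(?N := w)) = num T j y x"
    "\<And>j. j < ?N \<Longrightarrow> den T j y (x(?N := w)) = den T j y x" for x w
    using assms by (auto intro!: eq simp: tower_def)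
  have all: "(\<forall>j<length (T @ [(n, F, G)]). P j) \<longleftrightarrow> (\<forall>j<?N. P j) \<and> P ?N" for P
    by (auto simp: less_Suc_eq)
  have iff: "x(?N := w) \<in> Sol (T @ [(n, F, G)]) y \<longleftrightarrow> G y x \<noteq> 0 \<and> w ^ n = F y x / G y x"
    if "x \<in> Sol T y" for x w
    using that unfolding Sol_def mem_Collect_eq all by (auto simp: nth_append eqs)
  \<comment> \<open>Setting the last entry to 0 recovers the solution of \<open>T\<close> that is
    being extended.\<close>
  have trunc: "x(?N := 0) \<in> Sol T y" if "x \<in> Sol (T @ [(n, F, G)]) y" for x
    using that unfolding Sol_def mem_Collect_eq all by (auto simp: nth_append eqs)
  show ?thesis
  proof (intro equalityI subsetI)
    fix x assume "x \<in> Sol (T @ [(n, F, G)]) y"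
    then show "x \<in> {x(?N := w) | x w. x \<in> Sol T y \<and> G y x \<noteq> 0 \<and> w ^ n = F y x / G y x}"
      using trunc[of x] iff[of "x(?N := 0)" "x ?N"]
      by (intro CollectI exI[of _ "x(?N := 0)"] exI[of _ "x ?N"]) simp
  qed (use iff in auto)
qed

lemma finite_Sol:
  assumes "tower T"
  shows "finite (Sol T y)"
  using assms
proof (induction T rule: rev_induct)
  case (snoc s T)
  obtain n F G where s: "s = (n, F, G)" by (cases s)
  have tw: "tower T" "n > 0" "admissible (length T) F" "admissible (length T) G"
    using snoc.prems by (auto simp: s tower_snoc)
  have "Sol (T @ [s]) y \<subseteq> (\<Union>x\<in>Sol T y. (\<lambda>w. x(length T := w)) ` {w. w ^ n = F y x / G y x})"
    unfolding s Sol_snoc[OF tw(1,3,4)] by auto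
  moreover have "finite {w. w ^ n = F y x / G y x}" for x
    using tw(2) by (rule finite_nth_roots)
  ultimately show ?case
    using snoc.IH[OF tw(1)] by (meson finite_UN_I finite_imageI finite_subset)
qed (simp add: Sol_Nil)

section \<open>Local sections of the solution space\<close>

text \<open>The zero conditions exclude branch points: over \<open>W\<close> a radicand has no zeros or is identically
  zero on each section.\<close>

definition cover ::
  "('e::topological_space \<Rightarrow> complex ^ 5) \<Rightarrow> step list \<Rightarrow> fn set \<Rightarrow> 'e set \<Rightarrow> ('e \<Rightarrow> nat \<Rightarrow> complex) set \<Rightarrow> bool"
  where "cover l T \<K> W \<X> \<longleftrightarrow>
    open W \<and> finite \<X> \<and> (\<forall>X\<in>\<X>. \<forall>i. continuous_on W (\<lambda>p. X p i)) \<and>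
    (\<forall>p\<in>W. Sol T (l p) = (\<lambda>X. X p) ` \<X>) \<and>
    (\<forall>X\<in>\<X>. \<forall>j<length T. zero_const (\<lambda>p. num T j (l p) (X p)) W) \<and>
    (\<forall>X\<in>\<X>. \<forall>K\<in>\<K>. zero_const (\<lambda>p. K (l p) (X p)) W)"

definition good ::
  "('e::topological_space \<Rightarrow> complex ^ 5) \<Rightarrow> step list \<Rightarrow> fn set \<Rightarrow> 'e \<Rightarrow> bool"
  where "good l T \<K> q \<longleftrightarrow> (\<exists>W \<X>. q \<in> W \<and> cover l T \<K> W \<X>)"

lemma cover_subset:
  assumes "cover l T \<K> W \<X>" "open V" "V \<subseteq> W"
  shows "cover l T \<K> V \<X>"
  using assms(1) continuous_on_subset[OF _ assms(3)] zero_const_subset[OF _ assms(3)] assms(2,3)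
  unfolding cover_def by (metis (no_types, lifting) subsetD)

lemma good_Nil: "good l [] {} q"
  unfolding good_def cover_def
  by (intro exI[of _ UNIV] exI[of _ "{\<lambda>_ _. 0}"]) (auto simp: Sol_Nil)

lemma good_refine:
  assumes "cover l T {} W \<X>" "q \<in> W" "finite \<K>"
    and reg: "\<And>X K. X \<in> \<X> \<Longrightarrow> K \<in> \<K> \<Longrightarrow>
      \<forall>\<^sub>F p in nhds q. K (l p) (X p) = 0 \<longleftrightarrow> K (l q) (X q) = 0"
  shows "good l T \<K> q"
proof -
  have fin: "finite \<X>" and "open W" using assms(1) by (auto simp: cover_def)
  have "\<forall>\<^sub>F p in nhds q. \<forall>X\<in>\<X>. \<forall>K\<in>\<K>. K (l p) (X p) = 0 \<longleftrightarrow> K (l q) (X q) = 0"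
    using fin assms(3) reg by (intro eventually_ball_finite ballI) auto
  then obtain S where S: "open S" "q \<in> S"
    "\<forall>p\<in>S. \<forall>X\<in>\<X>. \<forall>K\<in>\<K>. K (l p) (X p) = 0 \<longleftrightarrow> K (l q) (X q) = 0"
    by (auto simp: eventually_nhds)
  have "cover l T {} (S \<inter> W) \<X>"
    using assms(1) by (rule cover_subset) (use S \<open>open W\<close> in auto)
  moreover have "zero_const (\<lambda>p. K (l p) (X p)) (S \<inter> W)" if "X \<in> \<X>" "K \<in> \<K>" for X K
    using S(3) that unfolding zero_const_def by blast
  ultimately have "cover l T \<K> (S \<inter> W) \<X>"
    unfolding cover_def by blast
  then show ?thesis
    using S(2) assms(2) unfolding good_def by blast
qed

text \<open>With \<open>F\<close> and \<open>G\<close> among the test functions,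
  \<open>F / G\<close> satisfies the hypotheses of \<open>local_nth_roots\<close> along every
  section that survives. The test set becomes empty, since functions of the new entry can only be
  tested after the new sections exist.\<close>

lemma good_snoc:
  fixes l :: "'e::topological_space \<Rightarrow> complex ^ 5"
  assumes "good l T {F, G} q" "tower (T @ [(n, F, G)])" "continuous_on UNIV l"
  shows "good l (T @ [(n, F, G)]) {} q"
proof -
  let ?N = "length T" and ?T = "T @ [(n, F, G)]"
  obtain W \<X> where q: "q \<in> W" and cov: "cover l T {F, G} W \<X>"
    using assms(1) by (auto simp: good_def)
  have tw: "tower T" "n > 0" "admissible ?N F" "admissible ?N G"
    using assms(2) by (auto simp: tower_snoc)
  have W: "open W" "finite \<X>" and contX: "\<And>X i. X \<in> \<X> \<Longrightarrow> continuous_on W (\<lambda>p. X p i)"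
    and sol: "\<And>p. p \<in> W \<Longrightarrow> Sol T (l p) = (\<lambda>X. X p) ` \<X>"
    and zero: "\<And>X j. X \<in> \<X> \<Longrightarrow> j < ?N \<Longrightarrow> zero_const (\<lambda>p. num T j (l p) (X p)) W"
    and zeroFG: "\<And>X. X \<in> \<X> \<Longrightarrow> zero_const (\<lambda>p. F (l p) (X p)) W"
      "\<And>X. X \<in> \<X> \<Longrightarrow> zero_const (\<lambda>p. G (l p) (X p)) W"
    using cov unfolding cover_def by auto
  have contl: "continuous_on W l" using assms(3) by (rule continuous_on_subset) simp
  \<comment> \<open>By \<open>zero_const\<close> the value at \<open>q\<close> decides for all of
    \<open>W\<close> whether the denominator vanishes along \<open>X\<close>. Sections outside
    \<open>\<Y>\<close> have no extension and are dropped.\<close>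
  define \<Y> where "\<Y> = {X \<in> \<X>. G (l q) (X q) \<noteq> 0}"
  have \<Y>: "G (l p) (X p) \<noteq> 0 \<longleftrightarrow> X \<in> \<Y>" if "X \<in> \<X>" "p \<in> W" for X p
    using zeroFG(2)[OF that(1)] that q unfolding \<Y>_def zero_const_def by blast
  have "\<exists>V R. open V \<and> q \<in> V \<and> V \<subseteq> W \<and> finite R \<and> (\<forall>r\<in>R. continuous_on V r) \<and>
      (\<forall>p\<in>V. {w. w ^ n = F (l p) (X p) / G (l p) (X p)} = (\<lambda>r. r p) ` R)" if "X \<in> \<Y>" for X
  proof (rule local_nth_roots[OF W(1) q _ tw(2)])
    have X: "X \<in> \<X>" using that by (simp add: \<Y>_def)
    have "\<forall>p\<in>W. G (l p) (X p) \<noteq> 0"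
      using \<Y>[OF X] that by blast
    with admissible_continuous[OF tw(3) contl contX[OF X]]
      admissible_continuous[OF tw(4) contl contX[OF X]]
    show "continuous_on W (\<lambda>p. F (l p) (X p) / G (l p) (X p))"
      by (rule continuous_on_divide)
    show "zero_const (\<lambda>p. F (l p) (X p) / G (l p) (X p)) W"
      unfolding zero_const_def divide_eq_0_iff
      using \<Y>[OF X] that zeroFG(1)[OF X] unfolding zero_const_def by blast
  qed
  then obtain V R where V: "\<And>X. X \<in> \<Y> \<Longrightarrow> open (V X) \<and> q \<in> V X \<and> V X \<subseteq> W"
    and R: "\<And>X. X \<in> \<Y> \<Longrightarrow> finite (R X)" "\<And>X r. X \<in> \<Y> \<Longrightarrow> r \<in> R X \<Longrightarrow> continuous_on (V X) r"
    "\<And>X p. X \<in> \<Y> \<Longrightarrow> p \<in> V X \<Longrightarrow>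
      {w. w ^ n = F (l p) (X p) / G (l p) (X p)} = (\<lambda>r. r p) ` R X"
    by metis
  define W' where "W' = W \<inter> (\<Inter>X\<in>\<Y>. V X)"
  define ext where "ext X r p = (X p)(?N := r p)" for X :: "'e \<Rightarrow> nat \<Rightarrow> complex" and r p
  define \<X>' where "\<X>' = (\<Union>X\<in>\<Y>. ext X ` R X)"
  have fin: "finite \<Y>" using W(2) by (simp add: \<Y>_def)
  have W': "open W'" "q \<in> W'" "W' \<subseteq> W" "\<And>X. X \<in> \<Y> \<Longrightarrow> W' \<subseteq> V X"
    using W(1) V fin q by (auto simp: W'_def intro!: open_Int open_INT)
  have ext_eq: "H y (ext X r p) = H y (X p)" if "admissible j H" "j \<le> ?N" for H j y X r p
    by (rule admissible_cong[OF that(1)]) (use that(2) in \<open>auto simp: ext_def\<close>)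
  have "cover l ?T {} W' \<X>'"
    unfolding cover_def
  proof (intro conjI ballI allI impI)
    show "open W'" by fact
    show "finite \<X>'" using fin R(1) by (auto simp: \<X>'_def)
  next
    fix X' i assume "X' \<in> \<X>'"
    then obtain X r where X: "X \<in> \<Y>" "r \<in> R X" "X' = ext X r" by (auto simp: \<X>'_def)
    then have "X \<in> \<X>" by (simp add: \<Y>_def)
    have "continuous_on W' r" "continuous_on W' (\<lambda>p. X p i)"
      using continuous_on_subset[OF R(2)[OF X(1,2)] W'(4)[OF X(1)]]
        continuous_on_subset[OF contX[OF \<open>X \<in> \<X>\<close>] W'(3)] by auto
    then show "continuous_on W' (\<lambda>p. X' p i)"
      by (cases "i = ?N") (simp_all add: X ext_def)
  next
    fix p assume p: "p \<in> W'"
    then have pW: "p \<in> W" using W' by blast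
    have "Sol ?T (l p) =
      {(X p)(?N := w) | X w. X \<in> \<Y> \<and> w ^ n = F (l p) (X p) / G (l p) (X p)}"
      unfolding Sol_snoc[OF tw(1,3,4)] sol[OF pW] using \<Y>[OF _ pW] by (auto simp: \<Y>_def)
    also have "\<dots> = {(X p)(?N := r p) | X r. X \<in> \<Y> \<and> r \<in> R X}"
    proof -
      have "w ^ n = F (l p) (X p) / G (l p) (X p) \<longleftrightarrow> (\<exists>r\<in>R X. w = r p)" if "X \<in> \<Y>" for X w
        using R(3)[OF that, of p] W'(4)[OF that] p by blast
      then have "(X \<in> \<Y> \<and> w ^ n = F (l p) (X p) / G (l p) (X p)) \<longleftrightarrow> (X \<in> \<Y> \<and> (\<exists>r\<in>R X. w = r p))"
        for X w by (rule conj_cong[OF refl])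
      then show ?thesis by (simp only:) blast
    qed
    also have "\<dots> = (\<lambda>X. X p) ` \<X>'"
      unfolding \<X>'_def ext_def image_UN image_image by blast
    finally show "Sol ?T (l p) = (\<lambda>X. X p) ` \<X>'" .
  next
    fix X' j assume "X' \<in> \<X>'" and j: "j < length ?T"
    then obtain X r where X: "X \<in> \<Y>" "r \<in> R X" "X' = ext X r" by (auto simp: \<X>'_def)
    then have "X \<in> \<X>" by (simp add: \<Y>_def)
    have "admissible j (num ?T j)" using assms(2) j by (simp add: tower_def)
    from ext_eq[OF this] j have "(\<lambda>p. num ?T j (l p) (X' p)) = (\<lambda>p. num ?T j (l p) (X p))"
      unfolding X by auto
    moreover have "zero_const (\<lambda>p. num ?T j (l p) (X p)) W"
      using j zero[OF \<open>X \<in> \<X>\<close>, of j] zeroFG(1)[OF \<open>X \<in> \<X>\<close>]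
      by (cases "j < ?N") (simp_all add: nth_append)
    ultimately show "zero_const (\<lambda>p. num ?T j (l p) (X' p)) W'"
      using zero_const_subset[OF _ W'(3)] by simp
  qed auto
  then show ?thesis
    using W'(2) unfolding good_def by blast
qed

text \<open>Sections are only required to be continuous; holomorphy follows one radical at a time,
  because entry \<open>j\<close> is a continuous root of a function of earlier entries. This makes
  the zeros of test functions along sections accessible to the identity theorem.\<close>

lemma cover_holomorphic:
  assumes "cover l T \<K> W \<X>" "tower T" "\<And>i. (\<lambda>t. l t $ i) holomorphic_on UNIV" "X \<in> \<X>"
  shows "(\<lambda>t. X t j) holomorphic_on W"
proof (induction j rule: less_induct)
  case (less j)
  have W: "open W" and contX: "\<And>i. continuous_on W (\<lambda>p. X p i)"
    and zero: "\<And>j. j < length T \<Longrightarrow> zero_const (\<lambda>p. num T j (l p) (X p)) W"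
    and sol: "\<And>p. p \<in> W \<Longrightarrow> X p \<in> Sol T (l p)"
    using assms(1,4) unfolding cover_def by auto
  show ?case
  proof (cases "j < length T")
    case True
    have ad: "deg T j > 0" "admissible j (num T j)" "admissible j (den T j)"
      using assms(2) True by (auto simp: tower_def)
    have l: "(\<lambda>t. l t $ i) holomorphic_on W" for i
      by (rule holomorphic_on_subset[OF assms(3) subset_UNIV])
    let ?g = "\<lambda>t. num T j (l t) (X t) / den T j (l t) (X t)"
    have eqs: "den T j (l p) (X p) \<noteq> 0" "X p j ^ deg T j = ?g p" if "p \<in> W" for p
      using sol[OF that] True by (auto simp: Sol_def)
    from admissible_holomorphic[OF ad(2) W l less] admissible_holomorphic[OF ad(3) W l less] eqs(1)
    have "?g holomorphic_on W"
      by (rule holomorphic_on_divide)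
    moreover have "zero_const ?g W"
      using zero[OF True] eqs(1) unfolding zero_const_def divide_eq_0_iff by blast
    ultimately show ?thesis
      using holomorphic_on_continuous_nth_root[OF W contX _ ad(1)] eqs(2) by blast
  next
    case False
    then have "X p j = 0" if "p \<in> W" for p
      using sol[OF that] by (simp add: Sol_def)
    then show ?thesis
      by (metis holomorphic_on_const holomorphic_transform)
  qed
qed

section \<open>Abundance of good points, on complex lines and in open sets\<close>

lemma countable_not_good_refine:
  fixes l :: "complex \<Rightarrow> complex ^ 5"
  assumes "tower T" "\<And>i. (\<lambda>t. l t $ i) holomorphic_on UNIV" "finite \<K>"
    "\<And>K. K \<in> \<K> \<Longrightarrow> admissible (length T) K" "countable {t. \<not> good l T {} t}"
  shows "countable {t. \<not> good l T \<K> t}"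
proof -
  \<comment> \<open>Within one cover, a bad parameter is an irregular zero of one of the finitely
    many holomorphic functions \<open>K (l t) (X t)\<close>.\<close>
  have loc: "countable {t \<in> W. \<not> good l T \<K> t}" if cov: "cover l T {} W \<X>" for W \<X>
  proof -
    have W: "open W" and fin: "finite \<X>" using cov by (auto simp: cover_def)
    let ?B = "\<lambda>X K. {t \<in> W. \<not> (\<forall>\<^sub>F w in nhds t. K (l w) (X w) = 0 \<longleftrightarrow> K (l t) (X t) = 0)}"
    have "countable (?B X K)" if "X \<in> \<X>" "K \<in> \<K>" for X K
    proof (rule countable_irregular_zeros[OF _ W])
      show "(\<lambda>t. K (l t) (X t)) holomorphic_on W"
        by (rule admissible_holomorphic[OF assms(4)[OF that(2)] W])
           (rule holomorphic_on_subset[OF assms(2) subset_UNIV]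
             cover_holomorphic[OF cov assms(1,2) that(1)])+
    qed
    then have "countable (\<Union>X\<in>\<X>. \<Union>K\<in>\<K>. ?B X K)"
      by (intro countable_UN countable_finite[OF fin] countable_finite[OF assms(3)])
    moreover have "{t \<in> W. \<not> good l T \<K> t} \<subseteq> (\<Union>X\<in>\<X>. \<Union>K\<in>\<K>. ?B X K)"
      using good_refine[OF cov _ assms(3)] by blast
    ultimately show ?thesis by (rule countable_subset[rotated])
  qed
  \<comment> \<open>By Lindelof, countably many covers exhaust the parameters that are good for the
    empty test set, so the local countability becomes global.\<close>
  define \<F> where "\<F> = {W. \<exists>\<X>. cover l T {} W \<X>}"
  obtain \<F>' where \<F>': "\<F>' \<subseteq> \<F>" "countable \<F>'" "\<Union>\<F>' = \<Union>\<F>"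
    by (rule Lindelof_openin[of \<F> UNIV]) (auto simp: \<F>_def cover_def)
  have "countable (\<Union>W\<in>\<F>'. {t \<in> W. \<not> good l T \<K> t})"
    using \<F>' loc by (intro countable_UN) (auto simp: \<F>_def)
  moreover have "{t. \<not> good l T \<K> t} \<subseteq>
      {t. \<not> good l T {} t} \<union> (\<Union>W\<in>\<F>'. {t \<in> W. \<not> good l T \<K> t})"
  proof
    fix t assume t: "t \<in> {t. \<not> good l T \<K> t}"
    show "t \<in> {t. \<not> good l T {} t} \<union> (\<Union>W\<in>\<F>'. {t \<in> W. \<not> good l T \<K> t})"
    proof (cases "good l T {} t")
      case True
      then have "t \<in> \<Union>\<F>'" unfolding \<F>'(3) \<F>_def good_def by blast
      then show ?thesis using t by blast
    qed simp
  qed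
  ultimately show ?thesis
    using assms(5) by (meson countable_Un countable_subset)
qed

lemma continuous_on_vecI:
  fixes l :: "'a::topological_space \<Rightarrow> complex ^ 'n::finite"
  assumes "\<And>i. continuous_on S (\<lambda>t. l t $ i)"
  shows "continuous_on S l"
  using continuous_on_vec_lambda[of S "\<lambda>i t. l t $ i"] assms by simp

text \<open>The test set is generalised in the induction: passing to the next step calls the
  hypothesis with \<open>{F, G}\<close>, and only then are the sections refined for \<K>.\<close>

lemma countable_not_good:
  fixes l :: "complex \<Rightarrow> complex ^ 5"
  assumes "tower T" "\<And>i. (\<lambda>t. l t $ i) holomorphic_on UNIV" "finite \<K>"
    "\<And>K. K \<in> \<K> \<Longrightarrow> admissible (length T) K"
  shows "countable {t. \<not> good l T \<K> t}"
  using assms(1,3,4)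
proof (induction T arbitrary: \<K> rule: rev_induct)
  case Nil
  show ?case
    by (rule countable_not_good_refine) (use Nil assms(2) in \<open>auto simp: good_Nil\<close>)
next
  case (snoc s T)
  obtain n F G where s: "s = (n, F, G)" by (cases s)
  have tw: "tower T" "admissible (length T) F" "admissible (length T) G"
    using snoc.prems by (auto simp: s tower_snoc)
  have "continuous_on UNIV l"
    by (rule continuous_on_vecI) (rule holomorphic_on_imp_continuous_on[OF assms(2)])
  then have "{t. \<not> good l (T @ [s]) {} t} \<subseteq> {t. \<not> good l T {F, G} t}"
    using good_snoc snoc.prems(1) unfolding s by blast
  moreover have "countable {t. \<not> good l T {F, G} t}"
    by (rule snoc.IH) (use tw in auto)
  ultimately have "countable {t. \<not> good l (T @ [s]) {} t}"
    by (rule countable_subset)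
  then show ?case
    by (rule countable_not_good_refine[OF snoc.prems(1) assms(2) snoc.prems(2,3), rotated])
qed

lemma ex_zero_const:
  fixes \<F> :: "('e::topological_space \<Rightarrow> complex) set"
  assumes "finite \<F>" "open V" "V \<noteq> {}" "\<And>f. f \<in> \<F> \<Longrightarrow> continuous_on V f"
  shows "\<exists>V'\<subseteq>V. open V' \<and> V' \<noteq> {} \<and> (\<forall>f\<in>\<F>. zero_const f V')"
  using assms(1,4)
proof (induction \<F> rule: finite_induct)
  case empty
  then show ?case using assms by blast
next
  case (insert f \<F>)
  then obtain V' where V': "V' \<subseteq> V" "open V'" "V' \<noteq> {}" "\<forall>f\<in>\<F>. zero_const f V'"
    by blast
  show ?case
  proof (cases "\<exists>p\<in>V'. f p \<noteq> 0")
    case True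
    let ?V = "V' \<inter> f -` (- {0})"
    have "continuous_on V' f"
      using insert.prems V'(1) continuous_on_subset by blast
    then have "open ?V"
      using V'(2) continuous_on_open_vimage[of V' f] open_Compl[OF closed_singleton]
      by (metis Int_commute)
    then show ?thesis
      using V' True by (intro exI[of _ ?V]) (auto simp: zero_const_def)
  next
    case False
    then have "zero_const f V'" by (auto simp: zero_const_def)
    then show ?thesis using V' by blast
  qed
qed

text \<open>With \<open>l\<close> the identity this supplies the base point \<open>y\<close>.
  Countably many exceptions on a line say nothing about the two end points of the path, which have
  to be good themselves. Each test function is made \<open>zero_const\<close> by shrinking the open
  set, either to where it is nonzero or not at all.\<close>

lemma ex_good:
  fixes l :: "'e::topological_space \<Rightarrow> complex ^ 5"
  assumes "tower T" "continuous_on UNIV l" "finite \<K>"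
    "\<And>K. K \<in> \<K> \<Longrightarrow> admissible (length T) K" "open V" "V \<noteq> {}"
  shows "\<exists>q\<in>V. good l T \<K> q"
  using assms(1,3-6)
proof (induction T arbitrary: \<K> V rule: rev_induct)
  case Nil
  let ?\<F> = "(\<lambda>K p. K (l p) (\<lambda>_. 0)) ` \<K>"
  obtain V' where V': "V' \<subseteq> V" "open V'" "V' \<noteq> {}" "\<forall>f\<in>?\<F>. zero_const f V'"
    using ex_zero_const[of ?\<F> V] Nil
      admissible_continuous[OF Nil(3) continuous_on_subset[OF assms(2)], of _ V "\<lambda>_ _. 0"]
    by auto
  have "cover l [] \<K> V' {\<lambda>_ _. 0}"
    using V' by (auto simp: cover_def Sol_Nil)
  then show ?case
    using V' unfolding good_def by blast
next
  case (snoc s T)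
  obtain n F G where s: "s = (n, F, G)" by (cases s)
  have tw: "tower T" "admissible (length T) F" "admissible (length T) G"
    using snoc.prems by (auto simp: s tower_snoc)
  have "\<exists>q\<in>V. good l T {F, G} q"
    by (rule snoc.IH) (use tw snoc.prems in auto)
  then obtain q where "q \<in> V" and "good l T {F, G} q" by blast
  then have "good l (T @ [s]) {} q"
    using good_snoc snoc.prems(1) assms(2) unfolding s by blast
  then obtain W \<X> where W: "q \<in> W" "cover l (T @ [s]) {} W \<X>"
    unfolding good_def by blast
  let ?\<F> = "(\<lambda>(K, X) p. K (l p) (X p)) ` (\<K> \<times> \<X>)"
  have "\<exists>V'\<subseteq>V \<inter> W. open V' \<and> V' \<noteq> {} \<and> (\<forall>f\<in>?\<F>. zero_const f V')"
  proof (rule ex_zero_const)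
    show "finite ?\<F>" "open (V \<inter> W)"
      using W(2) snoc.prems by (auto simp: cover_def)
    show "V \<inter> W \<noteq> {}" using W(1) \<open>q \<in> V\<close> by blast
    fix f assume "f \<in> ?\<F>"
    then obtain K X where f: "K \<in> \<K>" "X \<in> \<X>" "f = (\<lambda>p. K (l p) (X p))" by auto
    have "continuous_on (V \<inter> W) (\<lambda>p. X p i)" for i
      using W(2) f(2) continuous_on_subset[of W _ "V \<inter> W"] by (auto simp: cover_def)
    then show "continuous_on (V \<inter> W) f"
      unfolding f(3)
      by (rule admissible_continuous[OF snoc.prems(3)[OF f(1)]
            continuous_on_subset[OF assms(2) subset_UNIV]])
  qed
  then obtain V' where V': "V' \<subseteq> V \<inter> W" "open V'" "V' \<noteq> {}" "\<forall>f\<in>?\<F>. zero_const f V'"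
    by blast
  have "cover l (T @ [s]) {} V' \<X>"
    using cover_subset[OF W(2)] V' by blast
  then have "cover l (T @ [s]) \<K> V' \<X>"
    using V'(4) unfolding cover_def by auto
  then show ?case
    using V' unfolding good_def by blast
qed

section \<open>Analytic functions of several variables\<close>

text \<open>Unconditional convergence in the complex numbers is absolute, so the series at one
  corner of a smaller polydisc dominates the series on that whole polydisc, and the Weierstrass
  M-test applies.\<close>

lemma analytic_Cm_uniform_limit:
  assumes "analytic_Cm m f" "length c = m"
  obtains r \<alpha> where "r > 0"
    "uniform_limit {z. length z = m \<and> (\<forall>i<m. cmod (z ! i - c ! i) \<le> r)}
       (\<lambda>A z. \<Sum>k\<in>A. \<alpha> k * (\<Prod>i<m. (z ! i - c ! i) ^ (k ! i))) f
       (finite_subsets_at_top {k. length k = m})"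
proof -
  obtain R \<alpha> where R: "R > 0" and sums: "\<And>z. length z = m \<Longrightarrow> (\<forall>i<m. cmod (z ! i - c ! i) < R) \<Longrightarrow>
      ((\<lambda>k. \<alpha> k * (\<Prod>i<m. (z ! i - c ! i) ^ (k ! i))) has_sum f z) {k. length k = m}"
    using assms unfolding analytic_Cm_def by blast
  define r where "r = R / 2"
  have r: "r > 0" "r < R" using R by (auto simp: r_def)
  define M where "M k = norm (\<alpha> k * (\<Prod>i<m. complex_of_real r ^ (k ! i)))" for k
  \<comment> \<open>The corner at which every coordinate difference equals \<open>r\<close>; as
    \<open>r < R\<close>, the series converges there.\<close>
  define z where "z = map (\<lambda>a. a + complex_of_real r) c"
  have z: "length z = m" "\<And>i. i < m \<Longrightarrow> z ! i - c ! i = complex_of_real r"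
    using assms(2) by (auto simp: z_def)
  have "((\<lambda>k. \<alpha> k * (\<Prod>i<m. (z ! i - c ! i) ^ (k ! i))) has_sum f z) {k. length k = m}"
    using z r by (intro sums) auto
  then have "(\<lambda>k. \<alpha> k * (\<Prod>i<m. complex_of_real r ^ (k ! i))) summable_on {k. length k = m}"
    using z(2) by (simp add: has_sum_imp_summable)
  then have M: "M summable_on {k. length k = m}"
    unfolding M_def by (simp only: summable_on_iff_abs_summable_on_complex)
  have "uniform_limit {z. length z = m \<and> (\<forall>i<m. cmod (z ! i - c ! i) \<le> r)}
       (\<lambda>A z. \<Sum>k\<in>A. \<alpha> k * (\<Prod>i<m. (z ! i - c ! i) ^ (k ! i))) f
       (finite_subsets_at_top {k. length k = m})"
  proof (rule Weierstrass_m_test_general'[OF _ _ M])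
    fix k z assume z: "z \<in> {z. length z = m \<and> (\<forall>i<m. cmod (z ! i - c ! i) \<le> r)}"
    have "(\<Prod>i<m. cmod (z ! i - c ! i) ^ (k ! i)) \<le> (\<Prod>i<m. r ^ (k ! i))"
      using z by (intro prod_mono) (auto intro!: power_mono)
    then show "norm (\<alpha> k * (\<Prod>i<m. (z ! i - c ! i) ^ (k ! i))) \<le> M k"
      using r unfolding M_def norm_mult prod_norm[symmetric] norm_power
      by (intro mult_left_mono) auto
  next
    fix z assume "z \<in> {z. length z = m \<and> (\<forall>i<m. cmod (z ! i - c ! i) \<le> r)}"
    then show "((\<lambda>k. \<alpha> k * (\<Prod>i<m. (z ! i - c ! i) ^ (k ! i))) has_sum f z) {k. length k = m}"
      using r(2) by (intro sums) (auto intro: le_less_trans)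
  qed
  with r(1) show ?thesis using that by blast
qed

lemma uniform_limit_reindex:
  assumes "uniform_limit S f g F" "\<And>t. t \<in> T \<Longrightarrow> h t \<in> S"
  shows "uniform_limit T (\<lambda>n t. f n (h t)) (\<lambda>t. g (h t)) F"
  using assms unfolding uniform_limit_iff by (fast elim: eventually_mono)

text \<open>Points of the domain of \<open>f\<close> are lists, so continuity is expressed through
  families of continuous coordinate functions; locally the composite is a uniform limit of finite
  sums.\<close>

lemma analytic_Cm_continuous:
  fixes u :: "nat \<Rightarrow> 'a::topological_space \<Rightarrow> complex"
  assumes "analytic_Cm m f" "\<And>i. i < m \<Longrightarrow> continuous_on UNIV (u i)"
  shows "continuous_on UNIV (\<lambda>s. f (map (\<lambda>i. u i s) [0..<m]))"
proof -
  have "\<exists>N. open N \<and> s0 \<in> N \<and> continuous_on N (\<lambda>s. f (map (\<lambda>i. u i s) [0..<m]))" for s0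
  proof -
    define c where "c = map (\<lambda>i. u i s0) [0..<m]"
    have c: "length c = m" "\<And>i. i < m \<Longrightarrow> c ! i = u i s0" by (auto simp: c_def)
    obtain r \<alpha> where r: "r > 0" and lim: "uniform_limit {z. length z = m \<and> (\<forall>i<m. cmod (z ! i - c ! i) \<le> r)}
         (\<lambda>A z. \<Sum>k\<in>A. \<alpha> k * (\<Prod>i<m. (z ! i - c ! i) ^ (k ! i))) f
         (finite_subsets_at_top {k. length k = m})"
      using analytic_Cm_uniform_limit[OF assms(1) c(1)] by blast
    define N where "N = (\<Inter>i\<in>{..<m}. {s. cmod (u i s - u i s0) < r})"
    have "open {s. cmod (u i s - u i s0) < r}" if "i < m" for i
      using assms(2)[OF that] by (intro open_Collect_less continuous_intros)
    then have N: "open N" "s0 \<in> N"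
      unfolding N_def using r by (auto intro!: open_INT)
    have "uniform_limit N
         (\<lambda>A s. \<Sum>k\<in>A. \<alpha> k * (\<Prod>i<m. (map (\<lambda>i. u i s) [0..<m] ! i - c ! i) ^ (k ! i)))
         (\<lambda>s. f (map (\<lambda>i. u i s) [0..<m])) (finite_subsets_at_top {k. length k = m})"
      by (rule uniform_limit_reindex[OF lim]) (auto simp: N_def c less_imp_le)
    then have "uniform_limit N
         (\<lambda>A s. \<Sum>k\<in>A. \<alpha> k * (\<Prod>i<m. (u i s - c ! i) ^ (k ! i)))
         (\<lambda>s. f (map (\<lambda>i. u i s) [0..<m])) (finite_subsets_at_top {k. length k = m})"
      by simp
    then have "continuous_on N (\<lambda>s. f (map (\<lambda>i. u i s) [0..<m]))"
    proof (rule uniform_limit_theorem[rotated])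
      have cont: "continuous_on N (u i)" if "i < m" for i
        using assms(2)[OF that] by (rule continuous_on_subset) simp
      show "\<forall>\<^sub>F A in finite_subsets_at_top {k. length k = m}.
          continuous_on N (\<lambda>s. \<Sum>k\<in>A. \<alpha> k * (\<Prod>i<m. (u i s - c ! i) ^ (k ! i)))"
        by (intro always_eventually allI continuous_intros cont) auto
    qed simp
    with N show ?thesis by blast
  qed
  then obtain N where N: "\<And>s. open (N s)" "\<And>s. s \<in> N s"
    "\<And>s. continuous_on (N s) (\<lambda>s. f (map (\<lambda>i. u i s) [0..<m]))"
    by metis
  have "continuous_on (\<Union>s. N s) (\<lambda>s. f (map (\<lambda>i. u i s) [0..<m]))"
    using N(1,3) by (rule continuous_on_open_UN)
  moreover have "(\<Union>s. N s) = UNIV" using N(2) by blast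
  ultimately show ?thesis by simp
qed

lemma analytic_Cm_holomorphic:
  assumes "analytic_Cm m f" "open W" "\<And>i. i < m \<Longrightarrow> u i holomorphic_on W"
  shows "(\<lambda>t. f (map (\<lambda>i. u i t) [0..<m])) holomorphic_on W"
proof -
  have "\<exists>\<delta>>0. (\<lambda>t. f (map (\<lambda>i. u i t) [0..<m])) holomorphic_on ball t0 \<delta>" if t0: "t0 \<in> W" for t0
  proof -
    define c where "c = map (\<lambda>i. u i t0) [0..<m]"
    have c: "length c = m" "\<And>i. i < m \<Longrightarrow> c ! i = u i t0" by (auto simp: c_def)
    obtain r \<alpha> where r: "r > 0" and lim: "uniform_limit {z. length z = m \<and> (\<forall>i<m. cmod (z ! i - c ! i) \<le> r)}
         (\<lambda>A z. \<Sum>k\<in>A. \<alpha> k * (\<Prod>i<m. (z ! i - c ! i) ^ (k ! i))) f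
         (finite_subsets_at_top {k. length k = m})"
      using analytic_Cm_uniform_limit[OF assms(1) c(1)] by blast
    have "\<forall>\<^sub>F t in nhds t0. cmod (u i t - u i t0) < r" if "i < m" for i
    proof -
      have "isCont (u i) t0"
        using holomorphic_on_imp_continuous_on[OF assms(3)[OF that]] assms(2) t0
        by (simp add: continuous_on_eq_continuous_at)
      then have "(u i \<longlongrightarrow> u i t0) (nhds t0)"
        by (simp add: isCont_def flip: tendsto_at_iff_tendsto_nhds)
      from tendstoD[OF this r] show ?thesis by (simp add: dist_norm)
    qed
    then have "\<forall>\<^sub>F t in nhds t0. \<forall>i\<in>{..<m}. cmod (u i t - u i t0) < r"
      by (intro eventually_ball_finite) auto
    moreover have "\<forall>\<^sub>F t in nhds t0. t \<in> W"
      using assms(2) t0 by (rule eventually_nhds_in_open)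
    ultimately have "\<forall>\<^sub>F t in nhds t0. t \<in> W \<and> (\<forall>i<m. cmod (u i t - u i t0) < r)"
      by eventually_elim auto
    then obtain \<epsilon> where \<epsilon>: "\<epsilon> > 0"
      "\<And>t. dist t t0 < \<epsilon> \<Longrightarrow> t \<in> W \<and> (\<forall>i<m. cmod (u i t - u i t0) < r)"
      unfolding eventually_nhds_metric by blast
    \<comment> \<open>Halving gives a closed disc inside the \<epsilon>-ball, as the theorem on
      uniform limits asks for continuity up to the boundary.\<close>
    define \<delta> where "\<delta> = \<epsilon> / 2"
    have \<delta>: "\<delta> > 0" "\<And>t. t \<in> cball t0 \<delta> \<Longrightarrow> t \<in> W \<and> (\<forall>i<m. cmod (u i t - u i t0) < r)"
      using \<epsilon> by (auto simp: \<delta>_def dist_commute)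
    have hol: "u i holomorphic_on cball t0 \<delta>" if "i < m" for i
      using assms(3)[OF that] by (rule holomorphic_on_subset) (use \<delta>(2) in auto)
    have "uniform_limit (cball t0 \<delta>)
         (\<lambda>A s. \<Sum>k\<in>A. \<alpha> k * (\<Prod>i<m. (map (\<lambda>i. u i s) [0..<m] ! i - c ! i) ^ (k ! i)))
         (\<lambda>s. f (map (\<lambda>i. u i s) [0..<m])) (finite_subsets_at_top {k. length k = m})"
      by (rule uniform_limit_reindex[OF lim]) (use \<delta>(2) in \<open>auto simp: c less_imp_le\<close>)
    then have "uniform_limit (cball t0 \<delta>)
         (\<lambda>A s. \<Sum>k\<in>A. \<alpha> k * (\<Prod>i<m. (u i s - c ! i) ^ (k ! i)))
         (\<lambda>s. f (map (\<lambda>i. u i s) [0..<m])) (finite_subsets_at_top {k. length k = m})"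
      by simp
    note lim' = this
    have ev: "\<forall>\<^sub>F A in finite_subsets_at_top {k. length k = m}.
        continuous_on (cball t0 \<delta>) (\<lambda>s. \<Sum>k\<in>A. \<alpha> k * (\<Prod>i<m. (u i s - c ! i) ^ (k ! i))) \<and>
        (\<lambda>s. \<Sum>k\<in>A. \<alpha> k * (\<Prod>i<m. (u i s - c ! i) ^ (k ! i))) holomorphic_on ball t0 \<delta>"
    proof (intro always_eventually allI)
      fix A :: "nat list set"
      have "(\<lambda>s. \<Sum>k\<in>A. \<alpha> k * (\<Prod>i<m. (u i s - c ! i) ^ (k ! i))) holomorphic_on cball t0 \<delta>"
        by (intro holomorphic_intros hol) auto
      then show "continuous_on (cball t0 \<delta>) (\<lambda>s. \<Sum>k\<in>A. \<alpha> k * (\<Prod>i<m. (u i s - c ! i) ^ (k ! i))) \<and>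
        (\<lambda>s. \<Sum>k\<in>A. \<alpha> k * (\<Prod>i<m. (u i s - c ! i) ^ (k ! i))) holomorphic_on ball t0 \<delta>"
        using holomorphic_on_imp_continuous_on holomorphic_on_subset ball_subset_cball by blast
    qed
    obtain "(\<lambda>t. f (map (\<lambda>i. u i t) [0..<m])) holomorphic_on ball t0 \<delta>"
      using holomorphic_uniform_limit[OF ev lim'] finite_subsets_at_top_neq_bot by metis
    with \<delta>(1) show ?thesis by blast
  qed
  then have "(\<lambda>t. f (map (\<lambda>i. u i t) [0..<m])) field_differentiable at t0" if "t0 \<in> W" for t0
    using that by (meson centre_in_ball holomorphic_on_imp_differentiable_at open_ball)
  then show ?thesis
    by (simp add: holomorphic_on_def field_differentiable_at_within)
qed

section \<open>Operations that preserve admissibility\<close>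

definition admissible_op :: "nat \<Rightarrow> (complex list \<Rightarrow> complex) \<Rightarrow> bool" where
  "admissible_op m \<Phi> \<longleftrightarrow> (\<forall>L Hs. length Hs = m \<longrightarrow> (\<forall>H\<in>set Hs. admissible L H) \<longrightarrow>
     admissible L (\<lambda>y x. \<Phi> (map (\<lambda>H. H y x) Hs)))"

lemma admissible_op_analytic:
  assumes "analytic_Cm m f"
  shows "admissible_op m f"
  unfolding admissible_op_def
proof (intro allI impI)
  fix L and Hs :: "fn list" assume Hs: "length Hs = m" "\<forall>H\<in>set Hs. admissible L H"
  have ad: "admissible L (Hs ! i)" if "i < m" for i
    using Hs that by simp
  have eq: "map (\<lambda>H. H y x) Hs = map (\<lambda>i. (Hs ! i) y x) [0..<m]" for y x
    by (rule nth_equalityI) (simp_all add: Hs(1))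
  show "admissible L (\<lambda>y x. f (map (\<lambda>H. H y x) Hs))"
    unfolding admissible_def
  proof (intro conjI allI impI)
    fix y x x' assume "\<forall>i<L. x i = (x' i :: complex)"
    then have "H y x = H y x'" if "H \<in> set Hs" for H
      using admissible_cong[of L H x x'] Hs(2) that by blast
    then have "map (\<lambda>H. H y x) Hs = map (\<lambda>H. H y x') Hs"
      by simp
    then show "f (map (\<lambda>H. H y x) Hs) = f (map (\<lambda>H. H y x') Hs)"
      by (rule arg_cong)
  next
    have "continuous_on UNIV (\<lambda>p. f (map (\<lambda>i. (Hs ! i) (fst p) (snd p)) [0..<m]))"
      using ad by (intro analytic_Cm_continuous[OF assms])
        (auto simp: admissible_def case_prod_unfold)
    then show "continuous_on UNIV (\<lambda>(y, x). f (map (\<lambda>H. H y x) Hs))"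
      by (simp add: eq case_prod_unfold)
  next
    fix W and u :: "complex \<Rightarrow> complex ^ 5" and x :: "complex \<Rightarrow> nat \<Rightarrow> complex"
    assume *: "open W" "\<forall>i. (\<lambda>t. u t $ i) holomorphic_on W"
      "\<forall>i. (\<lambda>t. x t i) holomorphic_on W"
    have "(\<lambda>t. f (map (\<lambda>i. (Hs ! i) (u t) (x t)) [0..<m])) holomorphic_on W"
      by (rule analytic_Cm_holomorphic[OF assms *(1)]) (use ad * in \<open>simp add: admissible_def\<close>)
    then show "(\<lambda>t. f (map (\<lambda>H. H (u t) (x t)) Hs)) holomorphic_on W"
      by (simp add: eq)
  qed
qed

lemma admissible_const: "admissible L (\<lambda>y x. c)"
  by (auto simp: admissible_def case_prod_unfold)

lemma admissible_proj: "admissible L (\<lambda>y x. y $ k)"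
  by (auto simp: admissible_def case_prod_unfold intro!: continuous_intros)

lemma admissible_var: "i < L \<Longrightarrow> admissible L (\<lambda>y x. x i)"
  using continuous_on_product_then_coordinatewise[OF continuous_on_snd[OF continuous_on_id]]
  by (auto simp: admissible_def case_prod_unfold)

lemma admissible_add: "admissible L F \<Longrightarrow> admissible L G \<Longrightarrow> admissible L (\<lambda>y x. F y x + G y x)"
  unfolding admissible_def case_prod_unfold
  by (auto intro!: continuous_on_add holomorphic_on_add arg_cong2[of _ _ _ _ "(+)"])

lemma admissible_diff: "admissible L F \<Longrightarrow> admissible L G \<Longrightarrow> admissible L (\<lambda>y x. F y x - G y x)"
  unfolding admissible_def case_prod_unfold
  by (auto intro!: continuous_on_diff holomorphic_on_diff arg_cong2[of _ _ _ _ "(-)"])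

lemma admissible_mult: "admissible L F \<Longrightarrow> admissible L G \<Longrightarrow> admissible L (\<lambda>y x. F y x * G y x)"
  unfolding admissible_def case_prod_unfold
  by (auto intro!: continuous_on_mult holomorphic_on_mult arg_cong2[of _ _ _ _ "(*)"])

section \<open>Coefficients as functions of the roots\<close>

lemma exhaust_5: "(i :: 5) = 0 \<or> i = 1 \<or> i = 2 \<or> i = 3 \<or> i = 4"
proof (induct i)
  case (of_int z)
  then have "z = 0 \<or> z = 1 \<or> z = 2 \<or> z = 3 \<or> z = 4" by fastforce
  then show ?case by auto
qed

definition idx :: "5 \<Rightarrow> nat" where
  "idx i = (if i = 0 then 0 else if i = 1 then 1 else if i = 2 then 2 else if i = 3 then 3 else 4)"

lemma idx_simps [simp]: "idx 0 = 0" "idx 1 = 1" "idx 2 = 2" "idx 3 = 3" "idx 4 = 4"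
  by (simp_all add: idx_def)

definition root_poly :: "complex ^ 5 \<Rightarrow> complex poly" where
  "root_poly y = (\<Prod>k\<in>UNIV. [:- (y $ k), 1:])"

definition coef :: "complex ^ 5 \<Rightarrow> complex ^ 5" where
  "coef y = (\<chi> i. coeff (root_poly y) (idx i))"

lemma quintic_coef: "quintic (coef y) = root_poly y"
proof (rule poly_eqI)
  fix n :: nat
  have "degree (root_poly y) = 5"
    unfolding root_poly_def by (subst degree_prod_eq_sum_degree) auto
  moreover have "lead_coeff (root_poly y) = 1"
    unfolding root_poly_def by (subst lead_coeff_prod) simp
  moreover have "n = 0 \<or> n = 1 \<or> n = 2 \<or> n = 3 \<or> n = 4 \<or> n = 5 \<or> n > 5"
    by arith
  moreover have "degree (quintic (coef y)) = 5"
    by (simp add: quintic_def)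
  ultimately show "coeff (quintic (coef y)) n = coeff (root_poly y) n"
    by (elim disjE) (simp_all add: quintic_def coef_def numeral_eq_Suc coeff_eq_0)
qed

lemma poly_quintic_coef: "poly (quintic (coef y)) z = 0 \<longleftrightarrow> (\<exists>k. z = y $ k)"
  by (auto simp: quintic_coef root_poly_def poly_prod)

lemma coef_permute:
  assumes "\<sigma> permutes UNIV"
  shows "coef (\<chi> i. y $ \<sigma> i) = coef y"
proof -
  have "root_poly (\<chi> i. y $ \<sigma> i) = root_poly y"
    unfolding root_poly_def using prod.permute[OF assms, of "\<lambda>k. [:- (y $ k), 1:]"] by simp
  then show ?thesis by (simp add: coef_def)
qed

text \<open>Multiplying in one linear factor at a time gives a recursion for the coefficients that
  uses only sums, differences and products.\<close>

lemma admissible_coef: "admissible L (\<lambda>y x. coef y $ i)"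
proof -
  have "admissible L (\<lambda>y x. coeff (\<Prod>k\<in>A. [:- (y $ k), 1:]) m)" if "finite A" for A :: "5 set" and m
    using that
  proof (induction A arbitrary: m rule: finite_induct)
    case empty
    then show ?case by (simp add: admissible_const)
  next
    case (insert k A)
    \<comment> \<open>The negation is written \<open>0 - y $ k\<close> so that
      \<open>admissible_diff\<close> covers it.\<close>
    have "coeff (\<Prod>k\<in>insert k A. [:- (y $ k), 1:]) m =
        (0 - y $ k) * coeff (\<Prod>k\<in>A. [:- (y $ k), 1:]) m +
        (if m = 0 then 0 else coeff (\<Prod>k\<in>A. [:- (y $ k), 1:]) (m - 1))" for y :: "complex ^ 5"
      using insert.hyps by (simp add: coeff_pCons split: nat.split)
    then show ?case
      by (cases "m = 0") (simp_all only: if_True if_False insert.IH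
          admissible_add admissible_mult admissible_diff admissible_const admissible_proj simp_thms)
  qed
  then show ?thesis by (simp add: coef_def root_poly_def)
qed

text \<open>The fundamental theorem of algebra. It ensures that a nonempty set of coefficients has a
  nonempty preimage in the space of roots.\<close>

lemma surj_coef: "\<exists>y. coef y = a"
proof -
  have deg: "degree (quintic a) = 5" and lead: "lead_coeff (quintic a) = 1"
    by (simp_all add: quintic_def)
  then have "quintic a \<noteq> 0" by auto
  then obtain A where A: "size A = 5" "quintic a = (\<Prod>x\<in>#A. [:-x, 1:])"
    using alg_closed_imp_factorization[of "quintic a"] deg lead by auto
  obtain xs where xs: "mset xs = A" using ex_mset by blast
  then have "length xs = 5" using A(1) by auto
  then obtain u0 u1 u2 u3 u4 where xs': "xs = [u0, u1, u2, u3, u4]"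
    by (auto simp: numeral_eq_Suc length_Suc_conv)
  define y :: "complex ^ 5" where "y = (\<chi> i. xs ! idx i)"
  have UNIV_5: "UNIV = {0, 1, 2, 3, 4 :: 5}" using exhaust_5 by auto
  have "prod g (UNIV :: 5 set) = g 0 * (g 1 * (g 2 * (g 3 * g 4)))" for g :: "5 \<Rightarrow> complex poly"
    unfolding UNIV_5 by simp
  then have "root_poly y = quintic a"
    unfolding root_poly_def A(2) xs[symmetric] by (simp only: y_def xs' vec_lambda_beta idx_simps) simp
  then have "quintic (coef y) = quintic a" by (simp add: quintic_coef)
  then have "coef y $ i = a $ i" for i
    using exhaust_5[of i] by (auto simp: quintic_def)
  then show ?thesis by (auto simp: vec_eq_iff)
qed

section \<open>Expressions as towers\<close>

text \<open>Factoring through \<open>coef\<close> amounts to invariance under permutations of the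
  roots, since the coefficients determine the roots up to order. In this form the solution sets over
  \<open>y\<close> and its permutation coincide at once.\<close>

definition symmetric :: "fn \<Rightarrow> bool" where
  "symmetric F \<longleftrightarrow> (\<forall>y y' x. coef y = coef y' \<longrightarrow> F y x = F y' x)"

definition symmetric_tower :: "step list \<Rightarrow> bool" where
  "symmetric_tower T \<longleftrightarrow> tower T \<and> (\<forall>j<length T. symmetric (num T j) \<and> symmetric (den T j))"

lemma symmetric_tower_snoc:
  "symmetric_tower (T @ [(n, F, G)]) \<longleftrightarrow> symmetric_tower T \<and> n > 0 \<and>
     admissible (length T) F \<and> admissible (length T) G \<and> symmetric F \<and> symmetric G"
  by (auto simp: symmetric_tower_def tower_snoc nth_append less_Suc_eq)

lemma symmetricD: "symmetric F \<Longrightarrow> coef y = coef y' \<Longrightarrow> F y = F y'"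
  unfolding symmetric_def by blast

lemma Sol_symmetric:
  assumes "symmetric_tower T" "coef y = coef y'"
  shows "Sol T y = Sol T y'"
proof -
  have "symmetric (num T j)" "symmetric (den T j)" if "j < length T" for j
    using assms(1) that by (simp_all add: symmetric_tower_def)
  then have "num T j y = num T j y'" "den T j y = den T j y'" if "j < length T" for j
    using that by (simp_all only: symmetricD[OF _ assms(2)])
  then show ?thesis by (simp add: Sol_def)
qed

text \<open>Quantifying over an arbitrary initial tower \<open>T\<close> lets the subexpressions be compiled one after
  the other without renumbering variables.\<close>

definition compiles :: "expr list \<Rightarrow> bool" where
  "compiles es \<longleftrightarrow> (\<forall>T. symmetric_tower T \<longrightarrow> (\<exists>S Hs. symmetric_tower (T @ S) \<and>
     length Hs = length es \<and> (\<forall>H\<in>set Hs. admissible (length (T @ S)) H \<and> symmetric H) \<and>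
     (\<forall>y x vs. x \<in> Sol T y \<longrightarrow> list_all2 (has_value (coef y)) es vs \<longrightarrow>
        (\<exists>x'\<in>Sol (T @ S) y. (\<forall>i<length T. x' i = x i) \<and> map (\<lambda>H. H y x') Hs = vs))))"

lemma compilesE:
  assumes "compiles es" "symmetric_tower T"
  obtains S Hs where "symmetric_tower (T @ S)" "length Hs = length es"
    "\<forall>H\<in>set Hs. admissible (length (T @ S)) H \<and> symmetric H"
    "\<And>y x vs. x \<in> Sol T y \<Longrightarrow> list_all2 (has_value (coef y)) es vs \<Longrightarrow>
      \<exists>x'\<in>Sol (T @ S) y. (\<forall>i<length T. x' i = x i) \<and> map (\<lambda>H. H y x') Hs = vs"
proof -
  from assms(1)[unfolded compiles_def, rule_format, OF assms(2)] show ?thesis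
    by (elim exE conjE) (rule that, assumption+, blast)
qed

lemma compiles_list:
  assumes "\<And>e. e \<in> set es \<Longrightarrow> compiles [e]"
  shows "compiles es"
  using assms
proof (induction es)
  case Nil
  show ?case
    unfolding compiles_def
    by (intro allI impI exI[of _ "[]"]) auto
next
  case (Cons e es)
  show ?case
    unfolding compiles_def
  proof (intro allI impI)
    fix T assume "symmetric_tower T"
    have "compiles [e]" using Cons.prems by simp
    from this \<open>symmetric_tower T\<close> obtain S1 Hs1 where S1: "symmetric_tower (T @ S1)" "length Hs1 = length [e]"
      "\<forall>H\<in>set Hs1. admissible (length (T @ S1)) H \<and> symmetric H"
      "\<And>y x vs. x \<in> Sol T y \<Longrightarrow> list_all2 (has_value (coef y)) [e] vs \<Longrightarrow>
        \<exists>x'\<in>Sol (T @ S1) y. (\<forall>i<length T. x' i = x i) \<and> map (\<lambda>H. H y x') Hs1 = vs"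
      by (rule compilesE) blast
    have "compiles es" using Cons by simp
    from this S1(1) obtain S2 Hs where S2: "symmetric_tower ((T @ S1) @ S2)" "length Hs = length es"
      "\<forall>H\<in>set Hs. admissible (length ((T @ S1) @ S2)) H \<and> symmetric H"
      "\<And>y x vs. x \<in> Sol (T @ S1) y \<Longrightarrow> list_all2 (has_value (coef y)) es vs \<Longrightarrow>
        \<exists>x'\<in>Sol ((T @ S1) @ S2) y. (\<forall>i<length (T @ S1). x' i = x i) \<and> map (\<lambda>H. H y x') Hs = vs"
      by (rule compilesE) blast
    obtain H where H: "Hs1 = [H]" using S1(2) by (auto simp: length_Suc_conv)
    have adH: "admissible (length (T @ S1)) H" "symmetric H" using S1(3) H by auto
    show "\<exists>S Hs. symmetric_tower (T @ S) \<and> length Hs = length (e # es) \<and>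
        (\<forall>H\<in>set Hs. admissible (length (T @ S)) H \<and> symmetric H) \<and>
        (\<forall>y x vs. x \<in> Sol T y \<longrightarrow> list_all2 (has_value (coef y)) (e # es) vs \<longrightarrow>
          (\<exists>x'\<in>Sol (T @ S) y. (\<forall>i<length T. x' i = x i) \<and> map (\<lambda>H. H y x') Hs = vs))"
    proof (intro exI[of _ "S1 @ S2"] exI[of _ "H # Hs"] conjI allI impI)
      show "\<forall>K\<in>set (H # Hs). admissible (length (T @ S1 @ S2)) K \<and> symmetric K"
        using S2(3) adH admissible_mono[OF adH(1), of "length (T @ S1 @ S2)"] by simp
    next
      fix y x vs assume x: "x \<in> Sol T y" and "list_all2 (has_value (coef y)) (e # es) vs"
      then obtain v vs' where vs: "vs = v # vs'" "has_value (coef y) e v"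
        "list_all2 (has_value (coef y)) es vs'"
        by (auto simp: list_all2_Cons1)
      obtain x1 where x1: "x1 \<in> Sol (T @ S1) y" "\<forall>i<length T. x1 i = x i" "H y x1 = v"
        using S1(4)[OF x, of "[v]"] vs(2) H by auto
      obtain x2 where x2: "x2 \<in> Sol ((T @ S1) @ S2) y" "\<forall>i<length (T @ S1). x2 i = x1 i"
        "map (\<lambda>H. H y x2) Hs = vs'"
        using S2(4)[OF x1(1) vs(3)] by blast
      \<comment> \<open>\<open>H\<close> reads only the entries of \<open>T @ S1\<close>, which the
        second extension keeps.\<close>
      have "H y x2 = v"
        using admissible_cong[OF adH(1), of x2 x1] x2(2) x1(3) by auto
      then show "\<exists>x'\<in>Sol (T @ S1 @ S2) y. (\<forall>i<length T. x' i = x i) \<and> map (\<lambda>H. H y x') (H # Hs) = vs"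
        using x1 x2 vs(1) by (intro bexI[of _ x2]) auto
    qed (use S2 in simp_all)
  qed
qed

lemma symmetric_map: "\<forall>H\<in>set Hs. symmetric H \<Longrightarrow> symmetric (\<lambda>y x. \<Phi> (map (\<lambda>H. H y x) Hs))"
  unfolding symmetric_def by (intro allI impI arg_cong[where f = \<Phi>] map_cong refl) blast

lemma compiles_op:
  assumes "compiles es" "admissible_op (length es) \<Phi>"
    and val: "\<And>a v. has_value a e v \<Longrightarrow> \<exists>vs. list_all2 (has_value a) es vs \<and> v = \<Phi> vs"
  shows "compiles [e]"
  unfolding compiles_def
proof (intro allI impI)
  fix T assume "symmetric_tower T"
  with assms(1) obtain S Hs where S: "symmetric_tower (T @ S)" "length Hs = length es"
    "\<forall>H\<in>set Hs. admissible (length (T @ S)) H \<and> symmetric H"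
    "\<And>y x vs. x \<in> Sol T y \<Longrightarrow> list_all2 (has_value (coef y)) es vs \<Longrightarrow>
      \<exists>x'\<in>Sol (T @ S) y. (\<forall>i<length T. x' i = x i) \<and> map (\<lambda>H. H y x') Hs = vs"
    by (rule compilesE) blast
  let ?H = "\<lambda>y x. \<Phi> (map (\<lambda>H. H y x) Hs)"
  show "\<exists>S Hs. symmetric_tower (T @ S) \<and> length Hs = length [e] \<and>
      (\<forall>H\<in>set Hs. admissible (length (T @ S)) H \<and> symmetric H) \<and>
      (\<forall>y x vs. x \<in> Sol T y \<longrightarrow> list_all2 (has_value (coef y)) [e] vs \<longrightarrow>
        (\<exists>x'\<in>Sol (T @ S) y. (\<forall>i<length T. x' i = x i) \<and> map (\<lambda>H. H y x') Hs = vs))"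
  proof (intro exI[of _ S] exI[of _ "[?H]"] conjI allI impI)
    show "\<forall>H\<in>set [?H]. admissible (length (T @ S)) H \<and> symmetric H"
      using S(2,3) assms(2) symmetric_map[of Hs] by (simp add: admissible_op_def)
  next
    fix y x vs assume x: "x \<in> Sol T y" and "list_all2 (has_value (coef y)) [e] vs"
    then obtain v where v: "vs = [v]" "has_value (coef y) e v" by (auto simp: list_all2_Cons1)
    then obtain us where "list_all2 (has_value (coef y)) es us" "v = \<Phi> us" using val by blast
    then show "\<exists>x'\<in>Sol (T @ S) y. (\<forall>i<length T. x' i = x i) \<and> map (\<lambda>H. H y x') [?H] = vs"
      using S(4)[OF x] v(1) by auto
  qed (use S in simp_all)
qed

text \<open>For the operations that are partial or multi-valued and so need a new entry: a quotient
  is the case \<open>n = 1\<close>, a radical the case \<Psi> = 1.\<close>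

lemma compiles_step:
  assumes "compiles es" "admissible_op (length es) \<Phi>" "admissible_op (length es) \<Psi>" "n > 0"
    and val: "\<And>a v. has_value a e v \<Longrightarrow>
      \<exists>vs. list_all2 (has_value a) es vs \<and> \<Psi> vs \<noteq> 0 \<and> v ^ n = \<Phi> vs / \<Psi> vs"
  shows "compiles [e]"
  unfolding compiles_def
proof (intro allI impI)
  fix T assume "symmetric_tower T"
  with assms(1) obtain S Hs where S: "symmetric_tower (T @ S)" "length Hs = length es"
    "\<forall>H\<in>set Hs. admissible (length (T @ S)) H \<and> symmetric H"
    "\<And>y x vs. x \<in> Sol T y \<Longrightarrow> list_all2 (has_value (coef y)) es vs \<Longrightarrow>
      \<exists>x'\<in>Sol (T @ S) y. (\<forall>i<length T. x' i = x i) \<and> map (\<lambda>H. H y x') Hs = vs"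
    by (rule compilesE) blast
  let ?N = "length (T @ S)"
  let ?F = "\<lambda>y x. \<Phi> (map (\<lambda>H. H y x) Hs)" and ?G = "\<lambda>y x. \<Psi> (map (\<lambda>H. H y x) Hs)"
  let ?H = "\<lambda>(y :: complex ^ 5) (x :: nat \<Rightarrow> complex). x ?N"
  have ad: "admissible ?N ?F" "admissible ?N ?G" "symmetric ?F" "symmetric ?G"
    using S(2,3) assms(2,3) symmetric_map[of Hs] by (simp_all add: admissible_op_def)
  show "\<exists>S Hs. symmetric_tower (T @ S) \<and> length Hs = length [e] \<and>
      (\<forall>H\<in>set Hs. admissible (length (T @ S)) H \<and> symmetric H) \<and>
      (\<forall>y x vs. x \<in> Sol T y \<longrightarrow> list_all2 (has_value (coef y)) [e] vs \<longrightarrow>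
        (\<exists>x'\<in>Sol (T @ S) y. (\<forall>i<length T. x' i = x i) \<and> map (\<lambda>H. H y x') Hs = vs))"
  proof (intro exI[of _ "S @ [(n, ?F, ?G)]"] exI[of _ "[?H]"] conjI allI impI)
    show "symmetric_tower (T @ S @ [(n, ?F, ?G)])"
      using symmetric_tower_snoc[of "T @ S"] S(1) ad \<open>n > 0\<close> by simp
    show "\<forall>H\<in>set [?H]. admissible (length (T @ S @ [(n, ?F, ?G)])) H \<and> symmetric H"
      by (auto simp: symmetric_def intro: admissible_var)
  next
    fix y x vs assume x: "x \<in> Sol T y" and "list_all2 (has_value (coef y)) [e] vs"
    then obtain v where v: "vs = [v]" "has_value (coef y) e v" by (auto simp: list_all2_Cons1)
    then obtain us where us: "list_all2 (has_value (coef y)) es us" "\<Psi> us \<noteq> 0" "v ^ n = \<Phi> us / \<Psi> us"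
      using val by blast
    then obtain x' where x': "x' \<in> Sol (T @ S) y" "\<forall>i<length T. x' i = x i" "map (\<lambda>H. H y x') Hs = us"
      using S(4)[OF x] by blast
    have "tower (T @ S)" using S(1) by (simp add: symmetric_tower_def)
    from Sol_snoc[OF this ad(1,2), of n y] have "x'(?N := v) \<in> Sol (T @ S @ [(n, ?F, ?G)]) y"
      using x' us by auto
    then show "\<exists>x'\<in>Sol (T @ S @ [(n, ?F, ?G)]) y. (\<forall>i<length T. x' i = x i) \<and> map (\<lambda>H. H y x') [?H] = vs"
      using x'(2) v(1) by (intro bexI[of _ "x'(?N := v)"]) auto
  qed simp
qed

lemma compiles_Coeff: "compiles [Coeff i]"
  unfolding compiles_def
proof (intro allI impI)
  fix T assume "symmetric_tower T"
  then show "\<exists>S Hs. symmetric_tower (T @ S) \<and> length Hs = length [Coeff i] \<and>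
      (\<forall>H\<in>set Hs. admissible (length (T @ S)) H \<and> symmetric H) \<and>
      (\<forall>y x vs. x \<in> Sol T y \<longrightarrow> list_all2 (has_value (coef y)) [Coeff i] vs \<longrightarrow>
        (\<exists>x'\<in>Sol (T @ S) y. (\<forall>i<length T. x' i = x i) \<and> map (\<lambda>H. H y x') Hs = vs))"
    by (intro exI[of _ "[]"] exI[of _ "[\<lambda>y x. coef y $ i]"])
       (auto simp: admissible_coef symmetric_def list_all2_Cons1 elim: has_value.cases)
qed

lemma admissible_op_binary:
  assumes "\<And>L F G. admissible L F \<Longrightarrow> admissible L G \<Longrightarrow> admissible L (\<lambda>y x. f (F y x) (G y x))"
  shows "admissible_op 2 (\<lambda>vs. f (vs ! 0) (vs ! 1))"
  unfolding admissible_op_def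
  using assms by (auto simp: numeral_2_eq_2 length_Suc_conv)

text \<open>Every occurrence of a subexpression gets its own steps. Repeated radicals can thus take
  different values, as \<open>has_value\<close> allows.\<close>

lemma compiles_well_formed: "well_formed e \<Longrightarrow> compiles [e]"
proof (induction e)
  case (Coeff i)
  show ?case by (rule compiles_Coeff)
next
  case (Analytic f es)
  show ?case
  proof (rule compiles_op[of es f])
    have "compiles [e]" if "e \<in> set es" for e
      by (rule Analytic.IH[OF that]) (use Analytic.prems that in simp)
    then show "compiles es" by (rule compiles_list)
    show "admissible_op (length es) f"
      by (rule admissible_op_analytic) (use Analytic.prems in simp)
    show "\<exists>vs. list_all2 (has_value a) es vs \<and> v = f vs" if "has_value a (Analytic f es) v" for a v
      using that by cases blast
  qed
next
  case (Add e1 e2)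
  have "compiles [e1, e2]" by (rule compiles_list) (use Add in auto)
  moreover have "admissible_op (length [e1, e2]) (\<lambda>vs. vs ! 0 + vs ! 1)"
    using admissible_op_binary[OF admissible_add] by (simp add: numeral_2_eq_2)
  moreover have "\<exists>vs. list_all2 (has_value a) [e1, e2] vs \<and> v = vs ! 0 + vs ! 1"
    if "has_value a (Add e1 e2) v" for a v
    using that by cases (rule exI[of _ "[_, _]"], simp)
  ultimately show ?case by (rule compiles_op)
next
  case (Sub e1 e2)
  have "compiles [e1, e2]" by (rule compiles_list) (use Sub in auto)
  moreover have "admissible_op (length [e1, e2]) (\<lambda>vs. vs ! 0 - vs ! 1)"
    using admissible_op_binary[OF admissible_diff] by (simp add: numeral_2_eq_2)
  moreover have "\<exists>vs. list_all2 (has_value a) [e1, e2] vs \<and> v = vs ! 0 - vs ! 1"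
    if "has_value a (Sub e1 e2) v" for a v
    using that by cases (rule exI[of _ "[_, _]"], simp)
  ultimately show ?case by (rule compiles_op)
next
  case (Mul e1 e2)
  have "compiles [e1, e2]" by (rule compiles_list) (use Mul in auto)
  moreover have "admissible_op (length [e1, e2]) (\<lambda>vs. vs ! 0 * vs ! 1)"
    using admissible_op_binary[OF admissible_mult] by (simp add: numeral_2_eq_2)
  moreover have "\<exists>vs. list_all2 (has_value a) [e1, e2] vs \<and> v = vs ! 0 * vs ! 1"
    if "has_value a (Mul e1 e2) v" for a v
    using that by cases (rule exI[of _ "[_, _]"], simp)
  ultimately show ?case by (rule compiles_op)
next
  case (Div e1 e2)
  have "compiles [e1, e2]" by (rule compiles_list) (use Div in auto)
  moreover have "admissible_op (length [e1, e2]) (\<lambda>vs. vs ! 0)"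
    using admissible_op_binary[of "\<lambda>u v. u"] by (simp add: numeral_2_eq_2)
  moreover have "admissible_op (length [e1, e2]) (\<lambda>vs. vs ! 1)"
    using admissible_op_binary[of "\<lambda>u v. v"] by (simp add: numeral_2_eq_2)
  moreover have "\<exists>vs. list_all2 (has_value a) [e1, e2] vs \<and> vs ! 1 \<noteq> 0 \<and> v ^ 1 = vs ! 0 / vs ! 1"
    if "has_value a (Div e1 e2) v" for a v
    using that by cases (rule exI[of _ "[_, _]"], simp)
  ultimately show ?case by (rule compiles_step[OF _ _ _ zero_less_one])
next
  case (Radical n e)
  show ?case
  proof (rule compiles_step[of "[e]" "\<lambda>vs. vs ! 0" "\<lambda>vs. 1" n])
    show "compiles [e]" "n > 0" using Radical by auto
    show "admissible_op (length [e]) (\<lambda>vs. vs ! 0)"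
      by (auto simp: admissible_op_def length_Suc_conv)
    show "admissible_op (length [e]) (\<lambda>vs. 1)"
      by (auto simp: admissible_op_def admissible_const)
    show "\<exists>vs. list_all2 (has_value a) [e] vs \<and> (1 :: complex) \<noteq> 0 \<and> v ^ n = vs ! 0 / 1"
      if "has_value a (Radical n e) v" for a v
      using that by cases (rule exI[of _ "[_]"], simp)
  qed
qed

lemma has_value_tower:
  assumes "well_formed e"
  obtains T H where "symmetric_tower T" "admissible (length T) H" "symmetric H"
    "\<And>y v. has_value (coef y) e v \<Longrightarrow> \<exists>x\<in>Sol T y. H y x = v"
proof -
  have "symmetric_tower []" by (simp add: symmetric_tower_def tower_Nil)
  from compiles_well_formed[OF assms] this obtain S Hs where S: "symmetric_tower S" "length Hs = 1"
    "\<forall>H\<in>set Hs. admissible (length S) H \<and> symmetric H"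
    "\<And>y x vs. x \<in> Sol [] y \<Longrightarrow> list_all2 (has_value (coef y)) [e] vs \<Longrightarrow>
      \<exists>x'\<in>Sol S y. map (\<lambda>H. H y x') Hs = vs"
    by (rule compilesE) simp
  obtain H where H: "Hs = [H]" using S(2) by (auto simp: length_Suc_conv)
  show ?thesis
  proof (rule that[of S H])
    show "\<exists>x\<in>Sol S y. H y x = v" if "has_value (coef y) e v" for y v
      using S(4)[of "\<lambda>_. 0" y "[v]"] that H by (simp add: Sol_Nil)
  qed (use S H in auto)
qed

section \<open>Lifting paths to the tower\<close>

text \<open>The zero conditions belong to a lift because two lifts can separate only where a
  radicand vanishes; they are what \<open>lift_scale\<close> relies on.\<close>

definition is_lift ::
  "(real \<Rightarrow> complex ^ 5) \<Rightarrow> step list \<Rightarrow> fn set \<Rightarrow> real set \<Rightarrow> (real \<Rightarrow> nat \<Rightarrow> complex) \<Rightarrow> bool"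
  where "is_lift m T \<K> I x \<longleftrightarrow>
    (\<forall>i. continuous_on I (\<lambda>s. x s i)) \<and> (\<forall>s\<in>I. x s \<in> Sol T (m s)) \<and>
    (\<forall>j<length T. zero_const (\<lambda>s. num T j (m s) (x s)) I) \<and>
    (\<forall>K\<in>\<K>. zero_const (\<lambda>s. K (m s) (x s)) I)"

lemma is_lift_cong:
  assumes "is_lift m T \<K> I x" "\<And>s. s \<in> I \<Longrightarrow> x s = y s"
  shows "is_lift m T \<K> I y"
proof -
  have "continuous_on I (\<lambda>s. x s i) \<longleftrightarrow> continuous_on I (\<lambda>s. y s i)" for i
    using assms(2) by (intro continuous_on_cong) auto
  moreover have "zero_const (\<lambda>s. K (m s) (x s)) I \<longleftrightarrow> zero_const (\<lambda>s. K (m s) (y s)) I" for K :: fn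
    unfolding zero_const_def using assms(2) by (intro ball_cong refl) simp
  ultimately show ?thesis
    using assms unfolding is_lift_def by simp
qed

lemma is_lift_Un:
  assumes "is_lift m T \<K> I x" "is_lift m T \<K> J x" "closed I" "closed J" "I \<inter> J \<noteq> {}"
  shows "is_lift m T \<K> (I \<union> J) x"
  using assms(1,2) unfolding is_lift_def
  by (auto intro!: continuous_on_closed_Un[OF assms(3,4)] zero_const_Un[OF _ _ assms(5)])

text \<open>Over a short interval a lift is a local section composed with \<gamma>, and bisection
  glues these pieces. Every solution over the left end can be continued, since the sections of a
  cover exhaust the solutions.\<close>

lemma lift_exists:
  fixes l :: "'e::topological_space \<Rightarrow> complex ^ 5"
  assumes \<gamma>: "continuous_on {0..1} \<gamma>" and good: "\<And>s. s \<in> {0..1} \<Longrightarrow> good l T \<K> (\<gamma> s)"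
    and x0: "x0 \<in> Sol T (l (\<gamma> 0))"
  shows "\<exists>x. is_lift (\<lambda>s. l (\<gamma> s)) T \<K> {0..1} x \<and> x 0 = x0"
proof -
  let ?m = "\<lambda>s. l (\<gamma> s)"
  \<comment> \<open>The guards are implications because the local hypothesis of
    \<open>Bolzano\<close> also speaks of intervals that leave \<open>{0..1}\<close>.\<close>
  define P where "P a b \<longleftrightarrow> (0 \<le> a \<longrightarrow> a \<le> b \<longrightarrow> b \<le> 1 \<longrightarrow>
    (\<forall>x0\<in>Sol T (?m a). \<exists>x. is_lift ?m T \<K> {a..b} x \<and> x a = x0))" for a b
  have "P 0 1"
  proof (rule Bolzano)
    fix a b c :: real
    assume P: "P a b" "P b c" and abc: "a \<le> b" "b \<le> c"
    show "P a c"
      unfolding P_def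
    proof (intro impI ballI)
      fix x0 assume ac: "0 \<le> a" "c \<le> 1" and "x0 \<in> Sol T (?m a)"
      then obtain x where x: "is_lift ?m T \<K> {a..b} x" "x a = x0"
        using P(1) abc unfolding P_def by fastforce
      then have "x b \<in> Sol T (?m b)"
        using abc by (simp add: is_lift_def)
      then obtain x' where x': "is_lift ?m T \<K> {b..c} x'" "x' b = x b"
        using P(2) abc ac unfolding P_def by fastforce
      define z where "z s = (if s \<le> b then x s else x' s)" for s
      have "is_lift ?m T \<K> {a..b} z"
        by (rule is_lift_cong[OF x(1)]) (simp add: z_def)
      moreover have "is_lift ?m T \<K> {b..c} z"
        by (rule is_lift_cong[OF x'(1)]) (use x'(2) in \<open>auto simp: z_def\<close>)
      ultimately have "is_lift ?m T \<K> ({a..b} \<union> {b..c}) z"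
        by (rule is_lift_Un) (use abc in auto)
      moreover have "{a..b} \<union> {b..c} = {a..c}" using abc by auto
      moreover have "z a = x0" using x(2) abc by (simp add: z_def)
      ultimately show "\<exists>x. is_lift ?m T \<K> {a..c} x \<and> x a = x0" by auto
    qed
  next
    fix t :: real assume "0 \<le> t" "t \<le> 1"
    then have t: "t \<in> {0..1}" by simp
    obtain W \<X> where W: "\<gamma> t \<in> W" "cover l T \<K> W \<X>"
      using good[OF t] by (auto simp: good_def)
    then have "open W" by (simp add: cover_def)
    then obtain A where A: "open A" "t \<in> A" "\<And>s. s \<in> {0..1} \<Longrightarrow> s \<in> A \<Longrightarrow> \<gamma> s \<in> W"
      using \<gamma> W(1) t unfolding continuous_on_topological by metis
    obtain d where d: "d > 0" "ball t d \<subseteq> A"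
      using openE[OF A(1,2)] by blast
    show "\<exists>d>0. \<forall>a b. a \<le> t \<and> t \<le> b \<and> b - a < d \<longrightarrow> P a b"
    proof (intro exI[of _ d] conjI d(1) allI impI)
      fix a b :: real assume ab: "a \<le> t \<and> t \<le> b \<and> b - a < d"
      show "P a b"
        unfolding P_def
      proof (intro impI ballI)
        fix x0 assume *: "0 \<le> a" "a \<le> b" "b \<le> 1" and x0: "x0 \<in> Sol T (?m a)"
        have sub: "\<gamma> ` {a..b} \<subseteq> W"
        proof
          fix p assume "p \<in> \<gamma> ` {a..b}"
          then obtain s where s: "s \<in> {a..b}" "p = \<gamma> s" by blast
          then have "s \<in> ball t d" using ab by (auto simp: dist_real_def)
          then show "p \<in> W" using A(3)[of s] d(2) s * by auto
        qed
        then have "\<gamma> a \<in> W" using * by auto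
        then obtain X where X: "X \<in> \<X>" "X (\<gamma> a) = x0"
          using W(2) x0 unfolding cover_def by auto
        have "continuous_on {a..b} \<gamma>"
          using \<gamma> by (rule continuous_on_subset) (use * in auto)
        then have "continuous_on {a..b} (\<lambda>s. X (\<gamma> s) i)" for i
          using continuous_on_compose2[of W "\<lambda>p. X p i" "{a..b}" \<gamma>] W(2) X(1) sub
          by (auto simp: cover_def)
        moreover have "zero_const (\<lambda>s. K (l (\<gamma> s)) (X (\<gamma> s))) {a..b}"
          if "zero_const (\<lambda>p. K (l p) (X p)) W" for K :: fn
          using that sub unfolding zero_const_def by blast
        ultimately have "is_lift ?m T \<K> {a..b} (\<lambda>s. X (\<gamma> s))"
          using W(2) X(1) sub unfolding is_lift_def cover_def by (auto simp: image_subset_iff)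
        then show "\<exists>x. is_lift ?m T \<K> {a..b} x \<and> x a = x0"
          using X(2) by blast
      qed
    qed
  qed simp
  then show ?thesis using x0 by (simp add: P_def)
qed

text \<open>Lifts that agree below \<open>j\<close> have the same radicand at level
  \<open>j\<close>, so their entries there are roots of one function and keep their ratio.\<close>

lemma lift_scale:
  assumes "is_lift m T \<K> I x" "is_lift m T \<K> I x'" "tower T" "connected I"
    "\<And>s i. s \<in> I \<Longrightarrow> i < j \<Longrightarrow> x s i = x' s i" "a \<in> I" "x' a j = c * x a j" "s \<in> I"
  shows "x' s j = c * x s j"
proof (cases "j < length T")
  case True
  let ?h = "\<lambda>s. num T j (m s) (x s) / den T j (m s) (x s)"
  have ad: "deg T j > 0" "admissible j (num T j)" "admissible j (den T j)"
    using assms(3) True by (auto simp: tower_def)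
  have x: "den T j (m s) (x s) \<noteq> 0" "x s j ^ deg T j = ?h s" if "s \<in> I" for s
    using assms(1) True that by (auto simp: is_lift_def Sol_def)
  have x': "x' s j ^ deg T j = ?h s" if "s \<in> I" for s
  proof -
    have "x' s j ^ deg T j = num T j (m s) (x' s) / den T j (m s) (x' s)"
      using assms(2) True that by (auto simp: is_lift_def Sol_def)
    then show ?thesis
      using admissible_cong[OF ad(2), of "x s" "x' s"] admissible_cong[OF ad(3), of "x s" "x' s"]
        assms(5)[OF that] by simp
  qed
  show ?thesis
  proof (rule continuous_same_nth_power[OF assms(4) _ _ ad(1), where h = ?h and a = a])
    show "zero_const ?h I"
      using assms(1) True x(1) unfolding is_lift_def zero_const_def divide_eq_0_iff by blast
  qed (use assms x x' in \<open>auto simp: is_lift_def\<close>)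
next
  case False
  then show ?thesis
    using assms(1,2,8) by (simp add: is_lift_def Sol_def)
qed

text \<open>Unique lifting, level by level: the case \<open>c = 1\<close> of
  \<open>lift_scale\<close>.\<close>

lemma lift_agree:
  assumes "is_lift m T \<K> I x" "is_lift m T \<K> I x'" "tower T" "connected I" "a \<in> I"
    "\<forall>i<j. x a i = x' a i"
  shows "\<forall>i<j. \<forall>s\<in>I. x s i = x' s i"
  using assms(6)
proof (induction j)
  case (Suc j)
  then have IH: "\<forall>i<j. \<forall>s\<in>I. x s i = x' s i" by simp
  have "x' s j = 1 * x s j" if "s \<in> I" for s
    by (rule lift_scale[OF assms(1-4) _ assms(5) _ that]) (use IH Suc.prems in auto)
  with IH show ?case by (auto simp: less_Suc_eq)
qed simp

section \<open>Monodromy of the solutions\<close>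

text \<open>Monodromy maps commute with multiplying the \<open>j\<close>-th radical by a root of unity while all
  earlier radicals are kept.\<close>

definition equivariant :: "(nat \<Rightarrow> complex) set \<Rightarrow> ((nat \<Rightarrow> complex) \<Rightarrow> nat \<Rightarrow> complex) \<Rightarrow> bool" where
  "equivariant S g \<longleftrightarrow> (\<forall>x\<in>S. \<forall>x'\<in>S. \<forall>j c. (\<forall>i<j. x i = x' i) \<and> x' j = c * x j \<longleftrightarrow>
     (\<forall>i<j. g x i = g x' i) \<and> g x' j = c * g x j)"

text \<open>The tracking of roots is an equivalence for each index, so that it makes sense when
  \<open>H x\<close> is not a root and when some roots coincide.\<close>

definition monodromy ::
  "(nat \<Rightarrow> complex) set \<Rightarrow> ((nat \<Rightarrow> complex) \<Rightarrow> complex) \<Rightarrow> ('i \<Rightarrow> complex) \<Rightarrow>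
    ((nat \<Rightarrow> complex) \<Rightarrow> nat \<Rightarrow> complex) \<Rightarrow> ('i \<Rightarrow> 'i) \<Rightarrow> bool" where
  "monodromy S H r g \<sigma> \<longleftrightarrow> g permutes S \<and> equivariant S g \<and>
     (\<forall>x\<in>S. \<forall>i. H x = r i \<longleftrightarrow> H (g x) = r (\<sigma> i))"

lemma equivariantD:
  assumes "equivariant S g" "x \<in> S" "x' \<in> S"
  shows "(\<forall>i<j. x i = x' i) \<and> x' j = c * x j \<longleftrightarrow> (\<forall>i<j. g x i = g x' i) \<and> g x' j = c * g x j"
  using assms(1)[unfolded equivariant_def, rule_format, OF assms(2,3)] .

lemma monodromy_compose:
  assumes "monodromy S H r g \<sigma>" "monodromy S H r h \<tau>"
  shows "monodromy S H r (g \<circ> h) (\<sigma> \<circ> \<tau>)"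
proof -
  have h: "h x \<in> S" if "x \<in> S" for x
    using assms(2) that permutes_in_image[of h S x] by (simp add: monodromy_def)
  show ?thesis
    unfolding monodromy_def
  proof (intro conjI ballI allI)
    show "g \<circ> h permutes S"
      using assms by (auto simp: monodromy_def intro: permutes_compose)
    show "equivariant S (g \<circ> h)"
      unfolding equivariant_def o_def
    proof (intro ballI allI)
      fix x x' j c assume x: "x \<in> S" "x' \<in> S"
      have eq: "equivariant S g" "equivariant S h" using assms by (simp_all add: monodromy_def)
      show "(\<forall>i<j. x i = x' i) \<and> x' j = c * x j \<longleftrightarrow>
          (\<forall>i<j. g (h x) i = g (h x') i) \<and> g (h x') j = c * g (h x) j"
        unfolding equivariantD[OF eq(2) x] equivariantD[OF eq(1) h[OF x(1)] h[OF x(2)]] ..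
    qed
    show "H x = r i \<longleftrightarrow> H ((g \<circ> h) x) = r ((\<sigma> \<circ> \<tau>) i)" if "x \<in> S" for x i
    proof -
      have "H x = r i \<longleftrightarrow> H (h x) = r (\<tau> i)"
        using assms(2) that unfolding monodromy_def by blast
      also have "\<dots> \<longleftrightarrow> H (g (h x)) = r (\<sigma> (\<tau> i))"
        using assms(1) h[OF that] unfolding monodromy_def by blast
      finally show ?thesis by simp
    qed
  qed
qed

lemma monodromy_inv:
  assumes "monodromy S H r g \<sigma>" "bij \<sigma>"
  shows "monodromy S H r (inv g) (inv \<sigma>)"
proof -
  have g: "g permutes S" using assms(1) by (simp add: monodromy_def)
  have inv: "inv g x \<in> S" "g (inv g x) = x" if "x \<in> S" for x
    using that permutes_in_image[OF permutes_inv[OF g]] permutes_inverses[OF g] by auto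
  have "\<sigma> (inv \<sigma> i) = i" for i
    using assms(2) by (simp add: bij_is_surj surj_f_inv_f)
  show ?thesis
    unfolding monodromy_def
  proof (intro conjI ballI allI)
    show "inv g permutes S" by (rule permutes_inv[OF g])
    show "equivariant S (inv g)"
      unfolding equivariant_def
    proof (intro ballI allI)
      fix x x' j c assume x: "x \<in> S" "x' \<in> S"
      have "equivariant S g" using assms(1) by (simp add: monodromy_def)
      then show "(\<forall>i<j. x i = x' i) \<and> x' j = c * x j \<longleftrightarrow>
          (\<forall>i<j. inv g x i = inv g x' i) \<and> inv g x' j = c * inv g x j"
        by (simp only: equivariantD[of S g, OF _ inv(1)[OF x(1)] inv(1)[OF x(2)]] inv(2)[OF x(1)] inv(2)[OF x(2)])
    qed
    show "H x = r i \<longleftrightarrow> H (inv g x) = r (inv \<sigma> i)" if "x \<in> S" for x i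
      using assms(1) inv[OF that] \<open>\<sigma> (inv \<sigma> i) = i\<close> unfolding monodromy_def by metis
  qed
qed

section \<open>Commutators and 3-cycles\<close>

definition fixes_below :: "(nat \<Rightarrow> complex) set \<Rightarrow> nat \<Rightarrow> ((nat \<Rightarrow> complex) \<Rightarrow> nat \<Rightarrow> complex) \<Rightarrow> bool" where
  "fixes_below S k g \<longleftrightarrow> (\<forall>x\<in>S. \<forall>i<k. g x i = x i)"

text \<open>If \<open>g\<close> and \<open>h\<close> multiply entry \<open>k\<close> of
  \<open>z\<close> by \<xi> and \<eta>, then equivariance for the pairs \<open>z\<close>,
  \<open>h z\<close> and \<open>z\<close>, \<open>g z\<close>, which agree below \<open>k\<close>,
  carries these factors along. Both orders of composition multiply by \<xi> * \<eta>.\<close>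

lemma fixes_below_commutator:
  assumes "g permutes S" "h permutes S" "equivariant S g" "equivariant S h"
    "fixes_below S k g" "fixes_below S k h" "n > 0"
    and pow: "\<And>x x'. x \<in> S \<Longrightarrow> x' \<in> S \<Longrightarrow> \<forall>i<k. x i = x' i \<Longrightarrow> x k ^ n = x' k ^ n"
  shows "fixes_below S (Suc k) (g \<circ> h \<circ> inv g \<circ> inv h)"
  unfolding fixes_below_def
proof (intro ballI allI impI)
  fix x i assume x: "x \<in> S" and i: "i < Suc k"
  \<comment> \<open>With this \<open>z\<close> the claim is that \<open>g (h z)\<close> and
    \<open>h (g z) = x\<close> agree up to entry \<open>k\<close>.\<close>
  define z where "z = inv g (inv h x)"
  have z: "z \<in> S" "h (g z) = x"
    using x permutes_in_image[OF permutes_inv[OF assms(1)]] permutes_in_image[OF permutes_inv[OF assms(2)]]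
      permutes_inverses[OF assms(1)] permutes_inverses[OF assms(2)] by (auto simp: z_def)
  have gS: "g w \<in> S" and hS: "h w \<in> S" if "w \<in> S" for w
    using that permutes_in_image[OF assms(1)] permutes_in_image[OF assms(2)] by auto
  have keep: "g w i = w i" "h w i = w i" if "w \<in> S" "i < k" for w i
    using assms(5,6) that by (auto simp: fixes_below_def)
  have "g (h z) k = h (g z) k"
  proof (cases "z k = 0")
    case True
    have "g (h z) k ^ n = z k ^ n" "h (g z) k ^ n = z k ^ n"
      using z(1) keep gS hS by (auto intro!: pow)
    with True \<open>n > 0\<close> show ?thesis by (simp add: power_0_left)
  next
    case False
    define \<xi> \<eta> where "\<xi> = g z k / z k" and "\<eta> = h z k / z k"
    then have *: "g z k = \<xi> * z k" "h z k = \<eta> * z k" using False by simp_all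
    have "g (h z) k = \<eta> * g z k"
      using equivariantD[OF assms(3) z(1) hS[OF z(1)], of k \<eta>] keep z(1) *(2) by simp
    moreover have "h (g z) k = \<xi> * h z k"
      using equivariantD[OF assms(4) z(1) gS[OF z(1)], of k \<xi>] keep z(1) *(1) by simp
    ultimately show ?thesis using * by simp
  qed
  then have "g (h z) i = h (g z) i"
    using i keep z(1) gS hS by (cases "i = k") auto
  then show "(g \<circ> h \<circ> inv g \<circ> inv h) x i = x i"
    using z(2) by (simp add: z_def)
qed

definition cyc :: "'i \<Rightarrow> 'i \<Rightarrow> 'i \<Rightarrow> 'i \<Rightarrow> 'i" where
  "cyc a b c i = (if i = a then b else if i = b then c else if i = c then a else i)"

lemma inv_cyc:
  assumes "distinct [a, b, c]"
  shows "inv (cyc a b c) = cyc a c b"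
  by (rule inv_unique_comp) (use assms in \<open>auto simp: cyc_def fun_eq_iff\<close>)

lemma bij_cyc:
  assumes "distinct [a, b, c]"
  shows "bij (cyc a b c)"
  by (rule o_bij[of "cyc a c b"]) (use assms in \<open>auto simp: cyc_def fun_eq_iff\<close>)

text \<open>The two 3-cycles share only the letter \<open>a\<close>, which takes five letters. With
  four letters, commutators of 3-cycles lie in the Klein four-group.\<close>

lemma cyc_commutator:
  assumes "distinct [a, b, c, d, e]"
  shows "cyc a b d \<circ> cyc a c e \<circ> inv (cyc a b d) \<circ> inv (cyc a c e) = cyc a b c"
proof -
  have "inv (cyc a b d) = cyc a d b" "inv (cyc a c e) = cyc a e c"
    using assms by (auto intro!: inv_cyc)
  moreover have "cyc a b d (cyc a c e (cyc a d b (cyc a e c i))) = cyc a b c i" for i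
  proof -
    have neq: "a \<noteq> b" "b \<noteq> a" "a \<noteq> c" "c \<noteq> a" "a \<noteq> d" "d \<noteq> a" "a \<noteq> e" "e \<noteq> a" "b \<noteq> c" "c \<noteq> b"
      "b \<noteq> d" "d \<noteq> b" "b \<noteq> e" "e \<noteq> b" "c \<noteq> d" "d \<noteq> c" "c \<noteq> e" "e \<noteq> c" "d \<noteq> e" "e \<noteq> d"
      using assms by auto
    consider "i = a" | "i = b" | "i = c" | "i = d" | "i = e" | "i \<notin> {a, b, c, d, e}" by blast
    then show ?thesis
      by cases (simp_all add: cyc_def neq)
  qed
  ultimately show ?thesis by (simp add: fun_eq_iff)
qed

lemma ex_two_more:
  assumes "distinct [a, b, c :: 5]"
  obtains d e where "distinct [a, b, c, d, e]"
proof -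
  have "card (UNIV - {a, b, c}) = 2"
    using assms by (subst card_Diff_subset) auto
  then obtain d e where "UNIV - {a, b, c} = {d, e}" "d \<noteq> e"
    by (auto simp: card_2_iff)
  then have "d \<notin> {a, b, c}" "e \<notin> {a, b, c}" by blast+
  with assms \<open>d \<noteq> e\<close> show ?thesis by (intro that[of d e]) auto
qed

text \<open>Every 3-cycle on five letters is a commutator of two 3-cycles, so it is realised by monodromy
  maps arbitrarily deep in the derived series.\<close>

lemma ex_monodromy_fixes_below:
  fixes r :: "5 \<Rightarrow> complex"
  assumes "tower T" "k \<le> length T" "distinct [a, b, c]"
    and "\<And>a b c. distinct [a, b, c] \<Longrightarrow> \<exists>g. monodromy (Sol T y) H r g (cyc a b c)"
  shows "\<exists>g. monodromy (Sol T y) H r g (cyc a b c) \<and> fixes_below (Sol T y) k g"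
  using assms(2,3)
proof (induction k arbitrary: a b c)
  case 0
  then show ?case using assms(4) by (auto simp: fixes_below_def)
next
  case (Suc k)
  let ?S = "Sol T y"
  obtain d e where de: "distinct [a, b, c, d, e]" using ex_two_more[OF Suc.prems(2)] .
  have "\<exists>g. monodromy ?S H r g (cyc a b d) \<and> fixes_below ?S k g"
    "\<exists>g. monodromy ?S H r g (cyc a c e) \<and> fixes_below ?S k g"
    using Suc.prems de by (auto intro!: Suc.IH)
  then obtain g h where g: "monodromy ?S H r g (cyc a b d)" "fixes_below ?S k g"
    and h: "monodromy ?S H r h (cyc a c e)" "fixes_below ?S k h"
    by blast
  have k: "deg T k > 0" "admissible k (num T k)" "admissible k (den T k)"
    using assms(1) Suc.prems(1) by (auto simp: tower_def)
  have bij: "bij (cyc a b d)" "bij (cyc a c e)"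
    using de by (auto intro!: bij_cyc)
  have "monodromy ?S H r (g \<circ> h \<circ> inv g \<circ> inv h)
      (cyc a b d \<circ> cyc a c e \<circ> inv (cyc a b d) \<circ> inv (cyc a c e))"
    using g(1) h(1) bij by (intro monodromy_compose monodromy_inv)
  then have "monodromy ?S H r (g \<circ> h \<circ> inv g \<circ> inv h) (cyc a b c)"
    by (simp only: cyc_commutator[OF de])
  moreover have "fixes_below ?S (Suc k) (g \<circ> h \<circ> inv g \<circ> inv h)"
  proof (rule fixes_below_commutator[OF _ _ _ _ g(2) h(2) k(1)])
    fix x x' assume "x \<in> ?S" "x' \<in> ?S" and eq: "\<forall>i<k. x i = x' i"
    then have "x k ^ deg T k = num T k y x / den T k y x"
      "x' k ^ deg T k = num T k y x' / den T k y x'"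
      using Suc.prems(1) by (auto simp: Sol_def)
    then show "x k ^ deg T k = x' k ^ deg T k"
      using admissible_cong[OF k(2), of x x'] admissible_cong[OF k(3), of x x'] eq by simp
  qed (use g(1) h(1) in \<open>simp_all add: monodromy_def\<close>)
  ultimately show ?case by blast
qed

text \<open>Transfers goodness from a point of root space to a parameter of the line
  \<open>l\<close>. The comparison map \<phi> may differ from \<open>l\<close> by a permutation of
  the roots, which changes neither coefficients nor solutions and only renames the test
  functions.\<close>

lemma good_pullback:
  fixes l \<phi> :: "'e::topological_space \<Rightarrow> complex ^ 5"
  assumes "good (\<lambda>y. y) T \<K> (\<phi> t)" "continuous_on UNIV \<phi>" "symmetric_tower T"
    and coef: "\<And>s. coef (l s) = coef (\<phi> s)"
    and K: "\<And>K. K \<in> \<K>' \<Longrightarrow> \<exists>K'\<in>\<K>. \<forall>s. K (l s) = K' (\<phi> s)"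
  shows "good l T \<K>' t"
proof -
  obtain W \<X> where W: "\<phi> t \<in> W" and cov: "cover (\<lambda>y. y) T \<K> W \<X>"
    using assms(1) by (auto simp: good_def)
  have "open W" and contX: "\<And>X i. X \<in> \<X> \<Longrightarrow> continuous_on W (\<lambda>p. X p i)"
    using cov by (auto simp: cover_def)
  let ?W = "\<phi> -` W" and ?\<X> = "(\<lambda>X s. X (\<phi> s)) ` \<X>"
  have zc: "zero_const (\<lambda>s. K (\<phi> s) (X (\<phi> s))) ?W" if "zero_const (\<lambda>p. K p (X p)) W" for K :: fn and X
    using that unfolding zero_const_def by blast
  have num: "num T j (l s) = num T j (\<phi> s)" if "j < length T" for j s
    using assms(3) that by (intro symmetricD[OF _ coef]) (simp add: symmetric_tower_def)
  have "cover l T \<K>' ?W ?\<X>"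
    unfolding cover_def
  proof (intro conjI ballI allI impI)
    show "open ?W"
      using assms(2) \<open>open W\<close> by (simp add: continuous_on_open_vimage open_vimage)
    show "finite ?\<X>" using cov by (simp add: cover_def)
  next
    fix X' i assume "X' \<in> ?\<X>"
    then obtain X where X: "X \<in> \<X>" "X' = (\<lambda>s. X (\<phi> s))" by blast
    show "continuous_on ?W (\<lambda>s. X' s i)"
      unfolding X(2)
      by (rule continuous_on_compose2[OF contX[OF X(1)] continuous_on_subset[OF assms(2)]]) auto
  next
    fix s assume "s \<in> ?W"
    then show "Sol T (l s) = (\<lambda>X. X s) ` ?\<X>"
      using cov Sol_symmetric[OF assms(3) coef] by (auto simp: cover_def image_image)
  next
    fix X' j assume "X' \<in> ?\<X>" "j < length T"
    then show "zero_const (\<lambda>s. num T j (l s) (X' s)) ?W"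
      using cov zc[of "num T j"] by (auto simp: cover_def num)
  next
    fix X' K assume "X' \<in> ?\<X>" "K \<in> \<K>'"
    then obtain X K' where X: "X \<in> \<X>" "X' = (\<lambda>s. X (\<phi> s))" and K': "K' \<in> \<K>" "\<forall>s. K (l s) = K' (\<phi> s)"
      using K by blast
    then show "zero_const (\<lambda>s. K (l s) (X' s)) ?W"
      using cov zc[of K' X] by (auto simp: cover_def)
  qed
  with W show ?thesis unfolding good_def by blast
qed

text \<open>Since \<open>a\<close> and \<open>b\<close> are arbitrary points of the interval, the
  relation can be carried along the path in both directions; this yields the equivalence in
  \<open>equivariant\<close>.\<close>

lemma lift_equivariant:
  assumes "is_lift m T \<K> I x" "is_lift m T \<K> I x'" "tower T" "connected I" "a \<in> I" "b \<in> I"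
    "\<forall>i<j. x a i = x' a i" "x' a j = c * x a j"
  shows "(\<forall>i<j. x b i = x' b i) \<and> x' b j = c * x b j"
proof -
  have *: "\<forall>i<j. \<forall>s\<in>I. x s i = x' s i"
    using lift_agree[OF assms(1-5,7)] .
  moreover have "x' b j = c * x b j"
    by (rule lift_scale[OF assms(1-4) _ assms(5,8,6)]) (use * in auto)
  ultimately show ?thesis using assms(6) by blast
qed

lemma ex_monodromy:
  fixes y :: "complex ^ 5"
  assumes T: "symmetric_tower T" and H: "admissible (length T) H" "symmetric H"
    and good: "good (\<lambda>y. y) T (range (\<lambda>i y x. H y x - y $ i)) y" and \<sigma>: "\<sigma> permutes (UNIV :: 5 set)"
  shows "\<exists>g. monodromy (Sol T y) (H y) (\<lambda>i. y $ i) g \<sigma>"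
proof -
  let ?\<K> = "range (\<lambda>i y x. H y x - y $ i)"
  have tower: "tower T" using T by (simp add: symmetric_tower_def)
  define l where "l t = (\<chi> i. y $ i + t * (y $ \<sigma> i - y $ i))" for t
  have l0: "l 0 = y" by (simp add: l_def)
  have l1: "l 1 = (\<chi> i. y $ \<sigma> i)" by (simp add: l_def)
  have coef1: "coef (l 1) = coef y" unfolding l1 by (rule coef_permute[OF \<sigma>])
  have holl: "(\<lambda>t. l t $ i) holomorphic_on UNIV" for i
    by (simp add: l_def) (intro holomorphic_intros)
  have contl: "continuous_on UNIV l"
    by (rule continuous_on_vecI) (rule holomorphic_on_imp_continuous_on[OF holl])
  have "admissible (length T) K" if "K \<in> ?\<K>" for K
    using that H(1) by (auto intro!: admissible_diff admissible_proj)
  then have countable: "countable {t. \<not> good l T ?\<K> t}"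
    by (intro countable_not_good[OF tower holl]) auto
  have good0: "good l T ?\<K> 0"
    by (rule good_pullback[OF _ contl T]) (use good l0 in auto)
  \<comment> \<open>Goodness is known at \<open>y\<close>, not at the end point \<open>l 1\<close>.
    Undoing \<sigma> along the whole line gives a second line that passes through \<open>y\<close>
    at parameter 1.\<close>
  have good1: "good l T ?\<K> 1"
  proof (rule good_pullback[OF _ _ T, where \<phi> = "\<lambda>t. \<chi> i. l t $ inv \<sigma> i"])
    show "good (\<lambda>y. y) T ?\<K> (\<chi> i. l 1 $ inv \<sigma> i)"
      using good permutes_inverses(1)[OF \<sigma>] by (simp add: l1)
    show "continuous_on UNIV (\<lambda>t. \<chi> i. l t $ inv \<sigma> i)"
      using holomorphic_on_imp_continuous_on[OF holl] by (intro continuous_on_vec_lambda)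
    show coef: "coef (l s) = coef (\<chi> i. l s $ inv \<sigma> i)" for s
      using coef_permute[OF permutes_inv[OF \<sigma>], of "l s"] by simp
    fix K assume "K \<in> ?\<K>"
    then obtain i where K: "K = (\<lambda>y x. H y x - y $ i)" by blast
    have "K (l s) = (\<lambda>x. H (\<chi> i. l s $ inv \<sigma> i) x - (\<chi> i. l s $ inv \<sigma> i) $ \<sigma> i)" for s
      unfolding K symmetricD[OF H(2) coef[of s]] by (simp add: permutes_inverses(2)[OF \<sigma>])
    then show "\<exists>K'\<in>?\<K>. \<forall>s. K (l s) = K' (\<chi> i. l s $ inv \<sigma> i)"
      by (intro bexI[of _ "\<lambda>y x. H y x - y $ \<sigma> i"]) auto
  qed
  have "path_connected (- {t. \<not> good l T ?\<K> t})"
    by (rule path_connected_complement_countable[OF _ countable]) simp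
  then obtain \<gamma> where \<gamma>: "path \<gamma>" "path_image \<gamma> \<subseteq> - {t. \<not> good l T ?\<K> t}"
    "pathstart \<gamma> = 0" "pathfinish \<gamma> = 1"
    using good0 good1 unfolding path_connected_def by blast
  have \<gamma>01: "\<gamma> 0 = 0" "\<gamma> 1 = 1" using \<gamma>(3,4) by (auto simp: pathstart_def pathfinish_def)
  let ?S = "Sol T y" and ?m = "\<lambda>s. l (\<gamma> s)" and ?I = "{0..1 :: real}"
  have "\<forall>x0\<in>?S. \<exists>x. is_lift ?m T ?\<K> ?I x \<and> x 0 = x0"
  proof (intro ballI, rule lift_exists[where l = l and \<gamma> = \<gamma>])
    show "continuous_on {0..1} \<gamma>" using \<gamma>(1) by (simp add: path_def)
    show "good l T ?\<K> (\<gamma> s)" if "s \<in> {0..1}" for s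
      using subsetD[OF \<gamma>(2), of "\<gamma> s"] that by (simp add: path_image_def)
  qed (use \<gamma>01 l0 in simp)
  from bchoice[OF this] obtain L where
    L: "\<And>x. x \<in> ?S \<Longrightarrow> is_lift ?m T ?\<K> ?I (L x)" "\<And>x. x \<in> ?S \<Longrightarrow> L x 0 = x"
    by blast
  define g where "g x = (if x \<in> ?S then L x 1 else x)" for x
  have gS: "g x \<in> ?S" if "x \<in> ?S" for x
  proof -
    have "L x 1 \<in> Sol T (l (\<gamma> 1))" using L(1)[OF that] unfolding is_lift_def by simp
    then show ?thesis using that Sol_symmetric[OF T coef1] by (simp add: g_def \<gamma>01)
  qed
  have eq: "equivariant ?S g"
    unfolding equivariant_def
  proof (intro ballI allI iffI)
    fix x x' j c assume x: "x \<in> ?S" "x' \<in> ?S"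
    note lift = lift_equivariant[OF L(1)[OF x(1)] L(1)[OF x(2)] tower connected_Icc]
    show "(\<forall>i<j. g x i = g x' i) \<and> g x' j = c * g x j" if "(\<forall>i<j. x i = x' i) \<and> x' j = c * x j"
      using lift[of 0 1 j c] that x L(2) by (simp add: g_def)
    show "(\<forall>i<j. x i = x' i) \<and> x' j = c * x j" if "(\<forall>i<j. g x i = g x' i) \<and> g x' j = c * g x j"
      using lift[of 1 0 j c] that x L(2) by (simp add: g_def)
  qed
  \<comment> \<open>Equivariance read backwards with \<open>c = 1\<close>: images that agree in all
    entries come from solutions that agree in all entries.\<close>
  have "inj_on g ?S"
  proof (rule inj_onI)
    fix x x' assume "x \<in> ?S" "x' \<in> ?S" "g x = g x'"
    then have "x' j = 1 * x j" for j
      using eq unfolding equivariant_def by (metis mult_1)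
    then show "x = x'" by (simp add: fun_eq_iff)
  qed
  moreover have "g ` ?S = ?S"
    using gS by (intro endo_inj_surj finite_Sol tower calculation) auto
  ultimately have "g permutes ?S"
    by (intro bij_imp_permutes) (auto simp: bij_betw_def g_def)
  moreover have "H y x = y $ i \<longleftrightarrow> H y (g x) = y $ \<sigma> i" if "x \<in> ?S" for x i
  proof -
    \<comment> \<open>Between the ends of the path the test function with index \<open>i\<close>
      goes from comparing with \<open>y $ i\<close> to comparing with \<open>y $ \<sigma> i\<close>,
      while \<open>H\<close> is the same function at both ends by symmetry.\<close>
    have "zero_const (\<lambda>s. H (?m s) (L x s) - ?m s $ i) ?I"
      using L(1)[OF that] by (auto simp: is_lift_def)
    then have "H (?m 0) (L x 0) - ?m 0 $ i = 0 \<longleftrightarrow> H (?m 1) (L x 1) - ?m 1 $ i = 0"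
      unfolding zero_const_def by (meson atLeastAtMost_iff order_refl zero_le_one)
    then show ?thesis
      using L(2)[OF that] that symmetricD[OF H(2) coef1] by (simp add: \<gamma>01 l0 g_def) (simp add: l1)
  qed
  ultimately show ?thesis
    using eq unfolding monodromy_def by blast
qed

section \<open>Choice of the base point and the contradiction\<close>

lemma norm_axis_complex: "norm (axis i c :: complex ^ 'n) = norm c"
  unfolding norm_vec_def L2_set_def axis_def
  by (simp add: if_distrib[of norm] if_distrib[of "\<lambda>x. x ^ 2"] cong: if_cong)

theorem claim3p7:
  shows "\<not> (\<exists>e. root_formula e)"
proof
  assume "\<exists>e. root_formula e"
  then obtain e U where e: "well_formed e" and U: "open U" "closure U = UNIV"
    and val: "\<And>a z. a \<in> U \<Longrightarrow> poly (quintic a) z = 0 \<Longrightarrow> has_value a e z"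
    unfolding root_formula_def by blast
  obtain T H where T: "symmetric_tower T" and H: "admissible (length T) H" "symmetric H"
    and TH: "\<And>y v. has_value (coef y) e v \<Longrightarrow> \<exists>x\<in>Sol T y. H y x = v"
    using has_value_tower[OF e] by blast
  have tower: "tower T" using T by (simp add: symmetric_tower_def)
  have "continuous_on UNIV (\<lambda>y. coef y $ i)" for i
    using admissible_continuous[OF admissible_coef continuous_on_id, of UNIV "\<lambda>_ _. 0"] by simp
  then have "continuous_on UNIV coef" by (rule continuous_on_vecI)
  then have "open (coef -` U)"
    by (rule open_vimage[OF U(1)])
  moreover have "U \<noteq> {}" using U(2) by auto
  then obtain y1 where y1: "y1 \<in> coef -` U" using surj_coef by blast
  ultimately obtain \<epsilon> where \<epsilon>: "\<epsilon> > 0" "ball y1 \<epsilon> \<subseteq> coef -` U"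
    using openE by blast
  \<comment> \<open>The 3-cycle used at the end sends index 0 to 1, so these are the two roots that
    have to differ.\<close>
  define V where "V = coef -` U \<inter> {y. y $ 0 \<noteq> y $ 1}"
  have "open V"
    unfolding V_def
    by (rule open_Int[OF \<open>open (coef -` U)\<close>]) (intro open_Collect_neq continuous_intros)
  moreover have "V \<noteq> {}"
  proof (cases "y1 $ 0 = y1 $ 1")
    case True
    \<comment> \<open>If the two roots coincide, moving one of them by half the radius separates
      them inside the ball.\<close>
    define y2 where "y2 = y1 + axis 0 (complex_of_real (\<epsilon> / 2))"
    have "y2 \<in> ball y1 \<epsilon>"
      using \<epsilon>(1) by (simp add: y2_def dist_norm norm_axis_complex)
    moreover have "y2 $ 0 \<noteq> y2 $ 1"
      using True \<epsilon>(1) by (simp add: y2_def axis_def)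
    ultimately show ?thesis using \<epsilon>(2) unfolding V_def by blast
  qed (use y1 in \<open>auto simp: V_def\<close>)
  ultimately have "\<exists>y\<in>V. good (\<lambda>y. y) T (range (\<lambda>i y x. H y x - y $ i)) y"
    using H(1) by (intro ex_good tower continuous_on_id) (auto intro!: admissible_diff admissible_proj)
  then obtain y where y: "y \<in> V" "good (\<lambda>y. y) T (range (\<lambda>i y x. H y x - y $ i)) y"
    by blast
  let ?r = "\<lambda>i. y $ i"
  have "\<exists>g. monodromy (Sol T y) (H y) ?r g (cyc a b c)" if "distinct [a, b, c]" for a b c
    using bij_cyc[OF that] by (intro ex_monodromy[OF T H y(2)] bij_imp_permutes) auto
  moreover have "distinct [0, 1, 2 :: 5]" by simp
  ultimately obtain g where g: "monodromy (Sol T y) (H y) ?r g (cyc 0 1 2)"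
    "fixes_below (Sol T y) (length T) g"
    using ex_monodromy_fixes_below[OF tower order_refl] by blast
  have "poly (quintic (coef y)) (y $ 0) = 0" using poly_quintic_coef by blast
  then have "has_value (coef y) e (y $ 0)" using y(1) by (intro val) (simp_all add: V_def)
  then obtain x where x: "x \<in> Sol T y" "H y x = y $ 0" using TH by blast
  have "g x \<in> Sol T y"
    using g(1) x(1) permutes_in_image by (fastforce simp: monodromy_def)
  \<comment> \<open>\<open>g\<close> fixes the entries of the tower, and all further entries of a
    solution are 0.\<close>
  then have "g x i = x i" for i
    using g(2) x(1) by (cases "i < length T") (auto simp: fixes_below_def Sol_def)
  then have "g x = x" by blast
  then have "H y x = y $ cyc 0 1 2 0"
    using g(1) x unfolding monodromy_def by metis
  then show False
    using x(2) y(1) by (simp add: cyc_def V_def)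
qed

end
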